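(* Let $\Gamma$ be a bipartite distance-regular graph with vertex set $X$, diameter $D\ge4$ and valency $k\ge3$, and fix $x\in X$. Assume that for each $i$ with $2\le i\le D-2$ there exist complex scalars $\alpha_i,\beta_i$ such that for all $y,z\in X$ with $\partial(x,y)=2$, $\partial(x,z)=i$, $\partial(y,z)=i$, $$\alpha_i+\beta_i\,|\Gamma(x)\cap\Gamma(y)\cap\Gamma_{i-1}(z)|=|\Gamma_{i-1}(x)\cap\Gamma_{i-1}(y)\cap\Gamma(z)|,$$ and assume $\alpha_i=0$ for some $i$ with $3\le i\le D-2$. Then $|\Phi_2|\le1$ and $\Delta_2=0$.
   Context: $\Gamma$ is finite, connected, undirected, without loops or multiple edges; $\partial$ is path-length distance, $\Gamma_i(z)$ the set of vertices at distance $i$ from $z$, $\Gamma(z)=\Gamma_1(z)$; intersection numbers $p^h_{ij}=|\Gamma_i(u)\cap\Gamma_j(w)|$ for $\partial(u,w)=h$, $b_i=p^i_{1,i+1}$, $c_i=p^i_{1,i-1}$, $k$ the valency, $k_2=|\Gamma_2(x)|$; $\Delta_2=(k-2)(c_3-1)-(c_2-1)p^2_{22}$. Local eigenvalues: let $\Gamma^2_2(x)$ be the graph with vertex set $\Gamma_2(x)$ in which two vertices are adjacent iff they are at distance $2$ in $\Gamma$, and let $\eta_1,\dots,\eta_{k_2}$ be the eigenvalues (with multiplicity) of its adjacency matrix. It is known that these can be ordered so that $\eta_1=p^2_{22}$ and $\eta_i=b_3-1$ for $2\le i\le k$; then $\Phi_2=\{\eta_i: k+1\le i\le k_2\}$ (as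 a set). *)

theory Defs
  imports
    Complex_Main
    "HOL-Library.Multiset"
    "HOL-Computational_Algebra.Computational_Algebra"
    "Graph_Theory.Graph_Theory"
    "Jordan_Normal_Form.Char_Poly"
begin

text \<open>
  Simple undirected graphs are the symmetric, loop-free digraphs without parallel arcs
  of the locale \<^locale>\<open>pair_graph\<close>; an edge is a pair of opposite arcs.
\<close>

definition gdist :: "'a pair_pre_digraph \<Rightarrow> 'a \<Rightarrow> 'a \<Rightarrow> nat" where
  "gdist G u v = (LEAST n. \<exists>p. pre_digraph.apath (with_proj G) u p v \<and> length p = n)"

definition sphere :: "'a pair_pre_digraph \<Rightarrow> nat \<Rightarrow> 'a \<Rightarrow> 'a set" where
  "sphere G i z = {v \<in> pverts G. gdist G z v = i}"

definition diam :: "'a pair_pre_digraph \<Rightarrow> nat" where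
  "diam G = Max {gdist G u v | u v. u \<in> pverts G \<and> v \<in> pverts G}"

definition bipartite :: "'a pair_pre_digraph \<Rightarrow> bool" where
  "bipartite G \<longleftrightarrow> (\<exists>A B. pverts G = A \<union> B \<and> A \<inter> B = {} \<and>
     (\<forall>(u, v) \<in> parcs G. (u \<in> A \<and> v \<in> B) \<or> (u \<in> B \<and> v \<in> A)))"

definition distance_regular :: "'a pair_pre_digraph \<Rightarrow> bool" where
  "distance_regular G \<longleftrightarrow> pair_graph G \<and> Digraph_Component.connected (with_proj G) \<and>
     (\<forall>h i j. \<exists>p. \<forall>u \<in> pverts G. \<forall>w \<in> pverts G.
        gdist G u w = h \<longrightarrow> card (sphere G i u \<inter> sphere G j w) = p)"

text \<open>
  \<open>pnum G h i j\<close> is the intersection number $p^h_{ij}$. It is determined only when some pair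
  of vertices is at distance \<open>h\<close>, that is, for \<open>h \<le> diam G\<close>.
\<close>

definition pnum :: "'a pair_pre_digraph \<Rightarrow> nat \<Rightarrow> nat \<Rightarrow> nat \<Rightarrow> nat" where
  "pnum G h i j = (THE p. \<forall>u \<in> pverts G. \<forall>w \<in> pverts G.
     gdist G u w = h \<longrightarrow> card (sphere G i u \<inter> sphere G j w) = p)"

definition bnum :: "'a pair_pre_digraph \<Rightarrow> nat \<Rightarrow> nat" where
  "bnum G i = pnum G i 1 (i + 1)"

definition cnum :: "'a pair_pre_digraph \<Rightarrow> nat \<Rightarrow> nat" where
  "cnum G i = pnum G i 1 (i - 1)"

definition valency :: "'a pair_pre_digraph \<Rightarrow> nat" where
  "valency G = bnum G 0"

definition Delta2 :: "'a pair_pre_digraph \<Rightarrow> int" where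
  "Delta2 G = (int (valency G) - 2) * (int (cnum G 3) - 1)
              - (int (cnum G 2) - 1) * int (pnum G 2 2 2)"

definition adjacency_matrix :: "'a pair_pre_digraph \<Rightarrow> 'a list \<Rightarrow> complex mat" where
  "adjacency_matrix H vs = mat (length vs) (length vs)
     (\<lambda>(i, j). if (vs ! i, vs ! j) \<in> parcs H then 1 else 0)"

text \<open>
  Eigenvalues with algebraic multiplicity. Another enumeration of the vertices conjugates the
  matrix by a permutation matrix, so the choice does not matter.
\<close>

definition graph_spectrum :: "'a pair_pre_digraph \<Rightarrow> complex multiset" where
  "graph_spectrum H =
     proots (char_poly (adjacency_matrix H (SOME vs. distinct vs \<and> set vs = pverts H)))"

definition local_graph2 :: "'a pair_pre_digraph \<Rightarrow> 'a \<Rightarrow> 'a pair_pre_digraph" where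
  "local_graph2 G x = \<lparr> pverts = sphere G 2 x,
     parcs = {(y, z). y \<in> sphere G 2 x \<and> z \<in> sphere G 2 x \<and> gdist G y z = 2} \<rparr>"

text \<open>
  The entries $\eta_1 = p^2_{22}$ and $\eta_2 = \dots = \eta_k = b_3 - 1$ are removed from the
  multiset of all $k_2$ local eigenvalues, each with its own multiplicity; the set of what remains
  is $\Phi_2$. So $p^2_{22}$ or $b_3 - 1$ may still belong to $\Phi_2$. Lemma \<open>Phi2_ordering\<close>
  gives the description by an ordering.
\<close>

definition Phi2 :: "'a pair_pre_digraph \<Rightarrow> 'a \<Rightarrow> complex set" where
  "Phi2 G x = set_mset (graph_spectrum (local_graph2 G x)
     - {# of_nat (pnum G 2 2 2) #}
     - replicate_mset (valency G - 1) (of_nat (bnum G 3) - 1))"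

lemma Phi2_ordering:
  fixes \<eta> :: "nat \<Rightarrow> complex"
  assumes "graph_spectrum (local_graph2 G x) = image_mset \<eta> (mset_set {1..k2})"
    and "\<eta> 1 = of_nat (pnum G 2 2 2)"
    and "\<And>i. 2 \<le> i \<Longrightarrow> i \<le> valency G \<Longrightarrow> \<eta> i = of_nat (bnum G 3) - 1"
    and "1 \<le> valency G" "valency G \<le> k2"
  shows "Phi2 G x = \<eta> ` {valency G + 1..k2}"
proof -
  let ?k = "valency G"
  have eq: "{1..k2} = {1} \<union> ({2..?k} \<union> {?k+1..k2})"
    using assms(4,5) by auto
  have "mset_set {1..k2} = mset_set {1} + mset_set ({2..?k} \<union> {?k+1..k2})"
    unfolding eq using assms(4) by (intro mset_set_Union) auto
  also have "mset_set ({2..?k} \<union> {?k+1..k2}) = mset_set {2..?k} + mset_set {?k+1..k2}"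
    by (intro mset_set_Union) auto
  finally have "mset_set {1..k2} = mset_set {1} + (mset_set {2..?k} + mset_set {?k+1..k2})" .
  moreover have "image_mset \<eta> (mset_set {2..?k})
      = image_mset (\<lambda>_. of_nat (bnum G 3) - 1) (mset_set {2..?k})"
    using assms(3) by (intro image_mset_cong) auto
  ultimately have "graph_spectrum (local_graph2 G x) = {# of_nat (pnum G 2 2 2) #}
      + (replicate_mset (?k - 1) (of_nat (bnum G 3) - 1) + image_mset \<eta> (mset_set {?k+1..k2}))"
    using assms(1,2) by (simp add: image_mset_const_eq)
  then show ?thesis
    by (simp add: Phi2_def)
qed

end

theory Submission
  imports Defs
begin

text \<open>
  Fix \<open>x\<close> and let \<open>W\<close> be the space of functions on \<open>\<Gamma>\<^sub>2(x)\<close> that sum to zero over the neighbours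
  (in \<open>\<Gamma>\<^sub>2(x)\<close>) of every vertex of \<open>\<Gamma>(x)\<close>. For \<open>v \<in> W\<close> and a vertex \<open>z\<close> at distance \<open>i\<close> from \<open>x\<close> put
  \<open>v\<^sub>i\<^sup>+(z) = \<Sum> v(y)\<close> over \<open>\<partial>(y,z) = i - 2\<close> and \<open>v\<^sub>i\<^sup>0(z) = \<Sum> v(y)\<close> over \<open>\<partial>(y,z) = i\<close>. The raising map \<open>R\<close>
  sends \<open>v\<^sub>i\<^sub>-\<^sub>1\<^sup>+\<close> to \<open>c\<^sub>i\<^sub>-\<^sub>2 v\<^sub>i\<^sup>+\<close>, and the hypothesis says that it sends \<open>v\<^sub>i\<^sub>-\<^sub>1\<^sup>0\<close> to
  \<open>\<alpha>\<^sub>i v\<^sub>i\<^sup>0 + (c\<^sub>i - c\<^sub>i\<^sub>-\<^sub>2 - \<beta>\<^sub>i c\<^sub>2) v\<^sub>i\<^sup>+\<close>. Let \<open>i \<ge> 3\<close> be least with \<open>\<alpha>\<^sub>i = 0\<close>, and let \<open>B\<close> be the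
  adjacency operator of \<open>\<Gamma>\<^sub>2\<^sup>2(x)\<close>. Starting from \<open>v\<^sub>2\<^sup>0 = (Bv)\<^sub>2\<^sup>+\<close> one finds
  \<open>v\<^sub>j\<^sup>0 = r\<^sub>j (Bv)\<^sub>j\<^sup>+ + s\<^sub>j v\<^sub>j\<^sup>+\<close> with \<open>r\<^sub>j \<noteq> 0\<close> for \<open>j < i\<close>, and at \<open>i\<close> a linear relation between \<open>(Bv)\<^sub>i\<^sup>+\<close>
  and \<open>v\<^sub>i\<^sup>+\<close>. Since \<open>\<alpha>\<^sub>i = 0\<close>, the map \<open>v \<mapsto> v\<^sub>i\<^sup>+\<close> is injective on \<open>W\<close>: its kernel is killed by the
  distance-\<open>D\<close> matrix, which is invertible. Hence \<open>B\<close> is a scalar on \<open>W\<close>, the orthogonal complement of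
  the row space of the incidence matrix \<open>N\<close> between \<open>\<Gamma>(x)\<close> and \<open>\<Gamma>\<^sub>2(x)\<close>. As \<open>\<Gamma>\<^sub>2(x)\<close> contains pairs at
  distance 4, this forces \<open>N\<^sup>TN = c\<^sub>2 I + \<gamma> B\<close>. Counting gives \<open>\<gamma> p\<^sup>2\<^sub>2\<^sub>2 = c\<^sub>2 (k - 2)\<close> and
  \<open>\<gamma> (c\<^sub>3 - 1) = c\<^sub>2 (c\<^sub>2 - 1)\<close>, so \<open>\<Delta>\<^sub>2 = 0\<close>, and the spectrum of \<open>B\<close> is read off from \<open>NN\<^sup>T\<close>.
\<close>

section \<open>Path-length distance\<close>

context pair_graph
begin

text \<open>Closed subwalks can be cut out. So \<open>gdist\<close>, a minimum over paths, is also a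
  minimum over walks, and walks can be concatenated and reversed.\<close>

lemma apath_of_awalk:
  assumes "awalk u p v"
  shows "\<exists>q. apath u q v \<and> length q \<le> length p"
  using assms
proof (induction "length p" arbitrary: p rule: less_induct)
  case less
  show ?case
  proof (cases "distinct (awalk_verts u p)")
    case True
    then show ?thesis using less.prems by (auto simp: apath_def)
  next
    case False
    then obtain q r s where "p = q @ r @ s" "distinct (awalk_verts u q)"
      and w: "\<exists>w. awalk u q w \<and> awalk w r w \<and> awalk w s v" and "r \<noteq> []"
      using awalk_not_distinct_decomp[OF less.prems] by auto
    from w have "awalk u (q @ s) v" by (auto intro: awalk_appendI)
    moreover have "length (q @ s) < length p" using \<open>p = q @ r @ s\<close> \<open>r \<noteq> []\<close> by simp
    ultimately obtain q' where "apath u q' v" "length q' \<le> length (q @ s)"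
      using less.hyps by blast
    then show ?thesis using \<open>length (q @ s) < length p\<close> by force
  qed
qed

lemma gdist_le_length:
  assumes "awalk u p v"
  shows "gdist G u v \<le> length p"
proof -
  obtain q where "apath u q v" "length q \<le> length p"
    using apath_of_awalk[OF assms] by blast
  then have "gdist G u v \<le> length q" unfolding gdist_def by (intro Least_le) blast
  with \<open>length q \<le> length p\<close> show ?thesis by simp
qed

lemma awalk_rev:
  "awalk u p v \<Longrightarrow> \<exists>q. awalk v q u \<and> length q = length p"
proof (induction p arbitrary: u)
  case Nil
  then show ?case by (auto simp: awalk_Nil_iff)
next
  case (Cons e p)
  then have e: "e \<in> parcs G" "fst e = u" and w: "awalk (snd e) p v"
    by (auto simp: awalk_Cons_iff)
  obtain q where q: "awalk v q (snd e)" "length q = length p" using Cons.IH[OF w] by blast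
  have "(snd e, u) \<in> parcs G" using e pair_sym_arcs
    by (cases e) (auto simp: symmetric_def dest: symD)
  then have "awalk (snd e) [(snd e, u)] u"
    using in_arcsD2 by (auto simp: awalk_Cons_iff awalk_Nil_iff)
  then show ?case using q by (intro exI[of _ "q @ [(snd e, u)]"]) (auto intro: awalk_appendI)
qed

lemma gdist_self: "u \<in> pverts G \<Longrightarrow> gdist G u u = 0"
  using gdist_le_length[of u "[]" u] by (simp add: awalk_Nil_iff)

end

locale pair_connected_graph = pair_graph +
  assumes conn: "connected G"
begin

lemma gdist_awalk:
  assumes "u \<in> pverts G" "v \<in> pverts G"
  obtains p where "awalk u p v" "length p = gdist G u v"
proof -
  have "strongly_connected (with_proj G)"
    using symmetric_connected_imp_strongly_connected[OF _ conn] pair_sym_arcs by blast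
  then have "u \<rightarrow>\<^sup>*\<^bsub>with_proj G\<^esub> v" using assms by (auto simp: strongly_connected_def)
  then have "\<exists>n p. apath u p v \<and> length p = n" by (auto simp: reachable_apath)
  then have "\<exists>p. apath u p v \<and> length p = gdist G u v"
    unfolding gdist_def by (rule LeastI_ex)
  then show thesis using that by (auto simp: apath_def)
qed

lemma gdist_eq_0_iff:
  assumes "u \<in> pverts G" "v \<in> pverts G"
  shows "gdist G u v = 0 \<longleftrightarrow> u = v"
proof
  assume "gdist G u v = 0"
  then obtain p where "awalk u p v" "length p = 0" using gdist_awalk[OF assms] by metis
  then show "u = v" by (simp add: awalk_Nil_iff)
qed (use gdist_self assms in auto)

lemma gdist_sym:
  assumes "u \<in> pverts G" "v \<in> pverts G"
  shows "gdist G u v = gdist G v u"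
proof -
  have "gdist G b a \<le> gdist G a b" if ab: "a \<in> pverts G" "b \<in> pverts G" for a b
  proof -
    obtain p where "awalk a p b" "length p = gdist G a b" using gdist_awalk[OF ab] .
    then show ?thesis using awalk_rev gdist_le_length by metis
  qed
  then show ?thesis using assms by (meson order_antisym)
qed

lemma gdist_triangle:
  assumes "u \<in> pverts G" "v \<in> pverts G" "w \<in> pverts G"
  shows "gdist G u w \<le> gdist G u v + gdist G v w"
proof -
  obtain p where p: "awalk u p v" "length p = gdist G u v" using gdist_awalk assms(1,2) .
  obtain q where q: "awalk v q w" "length q = gdist G v w" using gdist_awalk assms(2,3) .
  have "gdist G u w \<le> length (p @ q)"
    using p(1) q(1) by (intro gdist_le_length awalk_appendI)
  then show ?thesis using p q by simp
qed

lemma gdist_geodesic: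
  assumes "u \<in> pverts G" "w \<in> pverts G" "j \<le> gdist G u w"
  shows "\<exists>v\<in>pverts G. gdist G u v = j \<and> gdist G v w = gdist G u w - j"
proof -
  obtain p where p: "awalk u p w" "length p = gdist G u w" using gdist_awalk assms(1,2) .
  \<comment> \<open>The vertex reached after \<open>j\<close> steps of a shortest walk; being closer
    to either end would violate the triangle inequality.\<close>
  let ?v = "last (pawalk_verts u (take j p))"
  have "awalk u (take j p @ drop j p) w" using p(1) by simp
  then have walks: "awalk u (take j p) ?v" "awalk ?v (drop j p) w"
    unfolding awalk_append_iff by simp_all
  then have v: "?v \<in> pverts G" by (blast dest: awalk_last_in_verts)
  have le: "gdist G u ?v \<le> j" "gdist G ?v w \<le> gdist G u w - j"
    using walks[THEN gdist_le_length] p(2) assms(3) by simp_all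
  have "gdist G u w \<le> gdist G u ?v + gdist G ?v w"
    using gdist_triangle[OF assms(1) v assms(2)] .
  with le assms(3) have "gdist G u ?v = j \<and> gdist G ?v w = gdist G u w - j" by linarith
  then show ?thesis using v by blast
qed

lemma gdist_parity:
  assumes "bipartite G" "u \<in> pverts G" "v \<in> pverts G" "w \<in> pverts G"
  shows "even (gdist G u v + gdist G v w + gdist G u w)"
proof -
  from assms(1) obtain A B where AB: "A \<inter> B = {}" "pverts G = A \<union> B"
    and arcs: "\<forall>(a, b) \<in> parcs G. a \<in> A \<and> b \<in> B \<or> a \<in> B \<and> b \<in> A"
    unfolding bipartite_def by auto
  have arc: "fst e \<in> A \<longleftrightarrow> snd e \<notin> A" if "e \<in> parcs G" for e
    using bspec[OF arcs that] AB(1) by auto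
  \<comment> \<open>Every arc changes sides, so the parity of the length tells whether the two ends
    lie on the same side.\<close>
  have walk: "even (length p) \<longleftrightarrow> (a \<in> A \<longleftrightarrow> b \<in> A)" if "awalk a p b" for a p b
    using that
  proof (induction p arbitrary: a)
    case (Cons e p)
    then have "e \<in> parcs G" "fst e = a" "awalk (snd e) p b"
      by (simp_all add: awalk_Cons_iff)
    then show ?case using Cons.IH[of "snd e"] arc[of e] by auto
  qed (auto simp: awalk_Nil_iff)
  have "even (gdist G a b) \<longleftrightarrow> (a \<in> A \<longleftrightarrow> b \<in> A)" if "a \<in> pverts G" "b \<in> pverts G" for a b
    using gdist_awalk[OF that] walk[of a _ b] by metis
  then show ?thesis using assms(2-4) by simp blast
qed

lemma diam_ge: "u \<in> pverts G \<Longrightarrow> v \<in> pverts G \<Longrightarrow> gdist G u v \<le> diam G"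
  and diam_attained: "\<exists>u\<in>pverts G. \<exists>v\<in>pverts G. gdist G u v = diam G"
proof -
  let ?X = "{gdist G u v | u v. u \<in> pverts G \<and> v \<in> pverts G}"
  have "?X = (\<lambda>(u, v). gdist G u v) ` (pverts G \<times> pverts G)" by auto
  then have fin: "finite ?X" using pair_finite_verts by simp
  show "gdist G u v \<le> diam G" if "u \<in> pverts G" "v \<in> pverts G" for u v
    unfolding diam_def using fin that by (intro Max_ge) auto
  obtain u where "u \<in> pverts G" using conn by (auto simp: connected_conv)
  then have "gdist G u u \<in> ?X" by blast
  then have "?X \<noteq> {}" by blast
  then have "diam G \<in> ?X" unfolding diam_def using fin by (rule Max_in[rotated])
  then obtain u v where "u \<in> pverts G" "v \<in> pverts G" "diam G = gdist G u v" by blast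
  then show "\<exists>u\<in>pverts G. \<exists>v\<in>pverts G. gdist G u v = diam G" by metis
qed

end

section \<open>Bipartite distance-regular metrics\<close>

text \<open>The graph enters only through its distance function, adjacency being distance 1;
  \<open>d_parity\<close> encodes bipartiteness. \<open>card_p\<close> determines
  \<open>p h i j\<close> only for distances \<open>h\<close> that occur.\<close>

locale bipartite_drg =
  fixes V :: "'a set" and d :: "'a \<Rightarrow> 'a \<Rightarrow> nat" and p :: "nat \<Rightarrow> nat \<Rightarrow> nat \<Rightarrow> nat" and D :: nat
  assumes finite_V: "finite V"
    and d_eq_0: "u \<in> V \<Longrightarrow> v \<in> V \<Longrightarrow> d u v = 0 \<longleftrightarrow> u = v"
    and d_sym: "u \<in> V \<Longrightarrow> v \<in> V \<Longrightarrow> d u v = d v u"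
    and d_triangle: "u \<in> V \<Longrightarrow> v \<in> V \<Longrightarrow> w \<in> V \<Longrightarrow> d u w \<le> d u v + d v w"
    and d_geodesic: "u \<in> V \<Longrightarrow> w \<in> V \<Longrightarrow> j \<le> d u w \<Longrightarrow> \<exists>v\<in>V. d u v = j \<and> d v w = d u w - j"
    and d_parity: "u \<in> V \<Longrightarrow> v \<in> V \<Longrightarrow> w \<in> V \<Longrightarrow> even (d u v + d v w + d u w)"
    and card_p: "u \<in> V \<Longrightarrow> w \<in> V \<Longrightarrow> card ({v\<in>V. d u v = i} \<inter> {v\<in>V. d w v = j}) = p (d u w) i j"
    and d_le_D: "u \<in> V \<Longrightarrow> v \<in> V \<Longrightarrow> d u v \<le> D"
    and D_attained: "\<exists>u\<in>V. \<exists>v\<in>V. d u v = D"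
begin

definition S :: "nat \<Rightarrow> 'a \<Rightarrow> 'a set" where "S i z = {v\<in>V. d z v = i}"
definition b :: "nat \<Rightarrow> nat" where "b i = p i 1 (i + 1)"
definition c :: "nat \<Rightarrow> nat" where "c i = p i 1 (i - 1)"
definition k :: nat where "k = b 0"

lemma in_S: "v \<in> S i z \<longleftrightarrow> v \<in> V \<and> d z v = i"
  by (simp add: S_def)

lemma finite_S [simp]: "finite (S i z)"
  using finite_V by (simp add: S_def)

lemma S_subset: "S i z \<subseteq> V"
  by (auto simp: S_def)

lemma card_S_Int: "u \<in> V \<Longrightarrow> w \<in> V \<Longrightarrow> card (S i u \<inter> S j w) = p (d u w) i j"
  using card_p by (simp add: S_def)

lemma d_self [simp]: "u \<in> V \<Longrightarrow> d u u = 0"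
  by (simp add: d_eq_0)

text \<open>The triangle inequality leaves a difference of at most 1, and parity excludes
  equality.\<close>

lemma neighbour_cases:
  assumes "y \<in> V" "z \<in> V" "u \<in> V" "d z u = 1"
  shows "d y u = d y z + 1 \<or> d y z = d y u + 1"
proof -
  have "d y u \<le> d y z + 1" "d y z \<le> d y u + 1"
    using d_triangle[of y z u] d_triangle[of y u z] d_sym[of u z] assms by auto
  moreover have "even (d y z + 1 + d y u)" using d_parity[of y z u] assms by simp
  ultimately show ?thesis by presburger
qed

lemma card_S_c:
  assumes "z \<in> V" "y \<in> V" "d y z = i + 1"
  shows "card (S 1 z \<inter> S i y) = c (i + 1)"
  using card_S_Int[of z y 1 i] assms d_sym[of z y] by (simp add: c_def)

lemma card_S_b:
  assumes "z \<in> V" "y \<in> V" "d y z = i"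
  shows "card (S 1 z \<inter> S (i + 1) y) = b i"
  using card_S_Int[of z y 1 "i+1"] assms d_sym[of z y] by (simp add: b_def)

lemma card_S_1: "z \<in> V \<Longrightarrow> card (S 1 z) = k"
  using card_S_b[of z z 0] by (simp add: k_def)

lemma b_plus_c:
  assumes "z \<in> V" "y \<in> V" "d y z = i + 1"
  shows "b (i + 1) + c (i + 1) = k"
proof -
  have "S 1 z = (S 1 z \<inter> S (i + 1 + 1) y) \<union> (S 1 z \<inter> S i y)"
    using neighbour_cases[OF assms(2,1)] assms(3) by (fastforce simp: in_S)
  moreover have "card ((S 1 z \<inter> S (i + 1 + 1) y) \<union> (S 1 z \<inter> S i y))
      = card (S 1 z \<inter> S (i + 1 + 1) y) + card (S 1 z \<inter> S i y)"
    by (rule card_Un_disjoint) (auto simp: in_S)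
  ultimately have "card (S 1 z) = card (S 1 z \<inter> S (i + 1 + 1) y) + card (S 1 z \<inter> S i y)" by simp
  then show ?thesis
    using card_S_b[OF assms] card_S_c[OF assms] card_S_1 assms(1) by simp
qed

lemma c_pos:
  assumes "z \<in> V" "y \<in> V" "d y z = i + 1"
  shows "c (i + 1) > 0"
proof -
  obtain u where "u \<in> V" "d y u = i" "d u z = 1"
    using d_geodesic[of y z i] assms by auto
  then have "u \<in> S 1 z \<inter> S i y" using assms d_sym[of u z] by (simp add: in_S)
  then have "card (S 1 z \<inter> S i y) > 0" by (auto simp: card_gt_0_iff)
  then show ?thesis using card_S_c[OF assms] by simp
qed

lemma pair_exists:
  assumes "i \<le> D"
  obtains u v where "u \<in> V" "v \<in> V" "d u v = i"
proof -
  obtain u w where uw: "u \<in> V" "w \<in> V" "d u w = D" using D_attained by blast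
  then obtain v where "v \<in> V" "d u v = i" using d_geodesic[of u w i] assms by blast
  then show thesis using that uw(1) by blast
qed

lemma c_pos':
  assumes "i < D"
  shows "c (i + 1) > 0"
proof -
  obtain u v where "u \<in> V" "v \<in> V" "d u v = i + 1" using pair_exists[of "i + 1"] assms by auto
  then show ?thesis using c_pos[of v u i] by blast
qed

lemma b_pos:
  assumes "i < D"
  shows "b i > 0"
proof -
  obtain u v where uv: "u \<in> V" "v \<in> V" "d u v = i + 1" using pair_exists[of "i+1"] assms by auto
  then obtain w where w: "w \<in> V" "d u w = i" "d w v = 1" using d_geodesic[of u v i] by auto
  then have "v \<in> S 1 w \<inter> S (i + 1) u" using uv by (simp add: in_S)
  then have "card (S 1 w \<inter> S (i + 1) u) > 0" by (auto simp: card_gt_0_iff)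
  then show ?thesis using card_S_b[of w u i] w uv by simp
qed

lemma p_pos:
  assumes "i + j \<le> D"
  shows "p i j (i + j) > 0"
proof -
  obtain u v where uv: "u \<in> V" "v \<in> V" "d u v = i + j" using pair_exists assms by metis
  then obtain w where w: "w \<in> V" "d u w = i" "d w v = j" using d_geodesic[of u v i] by auto
  then have "v \<in> S j w \<inter> S (i + j) u" using uv by (simp add: in_S)
  then have "card (S j w \<inter> S (i + j) u) > 0" by (auto simp: card_gt_0_iff)
  then show ?thesis using card_S_Int[of w u j "i+j"] w uv d_sym[of u w] by simp
qed

end

section \<open>Sums over the second neighbourhood of the base vertex\<close>

locale bipartite_drg_based = bipartite_drg +
  fixes x
  assumes x_in: "x \<in> V" and D_ge: "4 \<le> D" and k_ge: "3 \<le> k"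
begin

definition Y where "Y = S 2 x"

text \<open>For \<open>z\<close> at distance \<open>i\<close> from \<open>x\<close>, the functions \<open>v\<^sub>i\<^sup>+\<close> and \<open>v\<^sub>i\<^sup>0\<close> of the introduction are
  \<open>F (i - 2) v\<close> and \<open>F i v\<close>; on \<open>\<Gamma>\<^sub>2(x)\<close> the adjacency operator of the local graph is \<open>F 2\<close>.\<close>

definition F :: "nat \<Rightarrow> ('a \<Rightarrow> complex) \<Rightarrow> 'a \<Rightarrow> complex" where
  "F j v z = (\<Sum>y\<in>Y. of_bool (d y z = j) * v y)"

text \<open>Members are functions on the whole type, but only their values on \<open>Y\<close>
  matter to \<open>F\<close>.\<close>

definition W :: "('a \<Rightarrow> complex) set" where
  "W = {v. \<forall>w\<in>S 1 x. F 1 v w = 0}"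

text \<open>At index \<open>i - 1\<close> this is the number multiplied by \<beta> in the
  hypothesis; at index 1, with \<open>y\<close> and \<open>z\<close> in \<open>Y\<close>, it is an
  entry of \<open>N\<^sup>TN\<close>.\<close>

definition m :: "nat \<Rightarrow> 'a \<Rightarrow> 'a \<Rightarrow> nat" where
  "m i y z = card (S 1 x \<inter> S 1 y \<inter> S i z)"

lemma finite_Y [simp]: "finite Y"
  by (simp add: Y_def)

lemma in_Y: "y \<in> Y \<longleftrightarrow> y \<in> V \<and> d x y = 2"
  by (simp add: Y_def in_S)

lemma F_linear: "F j (\<lambda>y. r * v y + t * v' y) z = r * F j v z + t * F j v' z"
  unfolding F_def sum_distrib_left sum.distrib[symmetric] by (intro sum.cong refl) (simp add: algebra_simps)

lemma sum_F:
  assumes "finite U"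
  shows "(\<Sum>u\<in>U. F j v u) = (\<Sum>y\<in>Y. of_nat (card {u\<in>U. d y u = j}) * v y)"
proof -
  have "(\<Sum>u\<in>U. F j v u) = (\<Sum>y\<in>Y. (\<Sum>u\<in>U. of_bool (d y u = j)) * v y)"
    unfolding F_def by (subst sum.swap) (simp add: sum_distrib_right)
  also have "\<dots> = (\<Sum>y\<in>Y. of_nat (card {u\<in>U. d y u = j}) * v y)"
    using assms by (intro sum.cong refl) (simp add: Int_def)
  finally show ?thesis .
qed

lemma c2_pos: "c 2 > 0"
  using c_pos'[of 1] D_ge by (simp add: numeral_2_eq_2)

lemma card_common: "y \<in> Y \<Longrightarrow> card (S 1 x \<inter> S 1 y) = c 2"
  using card_S_c[of x y 1] x_in d_sym[of x y] by (simp add: in_Y numeral_2_eq_2)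

text \<open>Swapping sums gives a sum of \<open>F 1 v w\<close> over \<open>w\<close> in
  \<open>S 1 x \<inter> S i z\<close>, and each term vanishes on \<open>W\<close>.\<close>

lemma sum_m_W:
  assumes "v \<in> W" "z \<in> V"
  shows "(\<Sum>y\<in>Y. of_nat (m i y z) * v y) = 0"
proof -
  have "{w\<in>S 1 x \<inter> S i z. d y w = 1} = S 1 x \<inter> S 1 y \<inter> S i z" for y
    by (auto simp: in_S)
  then have "(\<Sum>y\<in>Y. of_nat (m i y z) * v y) = (\<Sum>w\<in>S 1 x \<inter> S i z. F 1 v w)"
    by (simp add: sum_F m_def)
  also have "\<dots> = 0" using assms by (simp add: W_def)
  finally show ?thesis .
qed

text \<open>Each \<open>y\<close> in \<open>Y\<close> has \<open>c 2\<close> neighbours in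
  \<open>S 1 x\<close>, so adding up the conditions of \<open>W\<close> counts every value
  \<open>c 2\<close> times.\<close>

lemma sum_W:
  assumes "v \<in> W"
  shows "(\<Sum>y\<in>Y. v y) = 0"
proof -
  have "of_nat (c 2) * (\<Sum>y\<in>Y. v y) = (\<Sum>y\<in>Y. of_nat (card {w\<in>S 1 x. d y w = 1}) * v y)"
    unfolding sum_distrib_left
  proof (intro sum.cong refl)
    fix y assume "y \<in> Y"
    then have "{w\<in>S 1 x. d y w = 1} = S 1 x \<inter> S 1 y" by (auto simp: in_S)
    then show "of_nat (c 2) * v y = of_nat (card {w\<in>S 1 x. d y w = 1}) * v y"
      using card_common \<open>y \<in> Y\<close> by simp
  qed
  also have "\<dots> = (\<Sum>w\<in>S 1 x. F 1 v w)" by (simp add: sum_F)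
  also have "\<dots> = 0" using assms by (simp add: W_def)
  finally show ?thesis using c2_pos by simp
qed

lemma d_Y_cases:
  assumes "z \<in> S i x" "y \<in> Y"
  shows "d y z + 2 = i \<or> d y z = i \<or> d y z = i + 2"
proof -
  have "d y z \<le> 2 + i" "i \<le> 2 + d y z" "even (2 + d y z + i)"
    using assms d_triangle[of y x z] d_triangle[of x y z] d_parity[of x y z] d_sym[of x y] x_in
    by (auto simp: in_Y in_S)
  then show ?thesis by presburger
qed

lemma F_sum_zero:
  assumes "v \<in> W" "z \<in> S i x" "2 \<le> i"
  shows "F (i - 2) v z + F i v z + F (i + 2) v z = 0"
proof -
  have "F (i - 2) v z + F i v z + F (i + 2) v z = (\<Sum>y\<in>Y. v y)"
    unfolding F_def sum.distrib[symmetric]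
  proof (intro sum.cong refl)
    fix y assume "y \<in> Y"
    then show "of_bool (d y z = i - 2) * v y + of_bool (d y z = i) * v y
        + of_bool (d y z = i + 2) * v y = v y"
      using d_Y_cases[OF assms(2), of y] assms(3) by auto
  qed
  then show ?thesis using sum_W assms(1) by simp
qed

text \<open>The three-term recurrence for the distance matrices; its middle term is absent because
  the graph is bipartite.\<close>

lemma sum_F_neighbours:
  assumes "z \<in> V"
  shows "(\<Sum>u\<in>S 1 z. F (j + 1) v u) = of_nat (b j) * F j v z + of_nat (c (j + 2)) * F (j + 2) v z"
proof -
  have "(\<Sum>u\<in>S 1 z. F (j + 1) v u) = (\<Sum>y\<in>Y. of_nat (card {u\<in>S 1 z. d y u = j + 1}) * v y)"
    by (simp add: sum_F)
  also have "\<dots> = (\<Sum>y\<in>Y. of_nat (b j) * (of_bool (d y z = j) * v y)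
      + of_nat (c (j + 2)) * (of_bool (d y z = j + 2) * v y))"
  proof (intro sum.cong refl)
    fix y assume "y \<in> Y"
    then have y: "y \<in> V" by (simp add: in_Y)
    have eq: "{u\<in>S 1 z. d y u = j + 1} = S 1 z \<inter> S (j + 1) y" by (auto simp: in_S)
    consider "d y z = j" | "d y z = j + 2" | "d y z \<noteq> j" "d y z \<noteq> j + 2" by blast
    then show "of_nat (card {u\<in>S 1 z. d y u = j + 1}) * v y = of_nat (b j) * (of_bool (d y z = j) * v y)
      + of_nat (c (j + 2)) * (of_bool (d y z = j + 2) * v y)"
    proof cases
      case 1
      then show ?thesis using card_S_b[OF assms y] unfolding eq by simp
    next
      case 2
      then show ?thesis using card_S_c[OF assms y, of "j + 1"] unfolding eq by simp
    next
      case 3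
      then have "S 1 z \<inter> S (j + 1) y = {}"
        using neighbour_cases[OF y assms] by (fastforce simp: in_S)
      then show ?thesis using 3 unfolding eq by simp
    qed
  qed
  also have "\<dots> = of_nat (b j) * F j v z + of_nat (c (j + 2)) * F (j + 2) v z"
    by (simp only: F_def sum.distrib sum_distrib_left)
  finally show ?thesis .
qed

lemma F_eq_0_of_far: "D < j \<Longrightarrow> z \<in> V \<Longrightarrow> F j v z = 0"
  unfolding F_def using d_le_D by (intro sum.neutral) (fastforce simp: in_Y)

lemma F_0: "z \<in> Y \<Longrightarrow> F 0 v z = v z"
proof -
  assume z: "z \<in> Y"
  have "F 0 v z = (\<Sum>y\<in>Y. if y = z then v z else 0)"
    unfolding F_def using z by (intro sum.cong refl) (auto simp: in_Y d_eq_0)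
  then show ?thesis using z by simp
qed

section \<open>The raising map\<close>

text \<open>A neighbour \<open>u\<close> of \<open>z\<close> with \<open>d y u = i\<close> satisfies
  \<open>d x u \<le> i + 2 < d x z\<close>, so it is automatically closer to \<open>x\<close>.
  Restricting the sum to such neighbours therefore loses nothing.\<close>

lemma F_raise_plus:
  assumes z: "z \<in> S (i + 3) x"
  shows "(\<Sum>u\<in>S 1 z \<inter> S (i + 2) x. F i v u) = of_nat (c (i + 1)) * F (i + 1) v z"
proof -
  have zV: "z \<in> V" using z by (simp add: in_S)
  have "(\<Sum>u\<in>S 1 z \<inter> S (i + 2) x. F i v u)
      = (\<Sum>y\<in>Y. of_nat (card {u\<in>S 1 z \<inter> S (i + 2) x. d y u = i}) * v y)"
    by (simp add: sum_F)
  also have "\<dots> = (\<Sum>y\<in>Y. of_nat (c (i + 1)) * (of_bool (d y z = i + 1) * v y))"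
  proof (intro sum.cong refl)
    fix y assume y: "y \<in> Y"
    then have yV: "y \<in> V" and xy: "d x y = 2" by (simp_all add: in_Y)
    have up: "i + 2 = d x u" if "u \<in> V" "d y u = i" "d z u = 1" for u
    proof -
      have "d x u \<le> 2 + i" using d_triangle[of x y u] that x_in yV xy by simp
      moreover have "d x u = d x z + 1 \<or> d x z = d x u + 1"
        using neighbour_cases[of x z u] that x_in zV by simp
      ultimately show ?thesis using z by (auto simp: in_S)
    qed
    then have eq: "{u\<in>S 1 z \<inter> S (i + 2) x. d y u = i} = S 1 z \<inter> S i y"
      by (auto simp: in_S)
    show "of_nat (card {u\<in>S 1 z \<inter> S (i + 2) x. d y u = i}) * v y
        = of_nat (c (i + 1)) * (of_bool (d y z = i + 1) * v y)"
    proof (cases "d y z = i + 1")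
      case True
      then show ?thesis unfolding eq using card_S_c[OF zV yV] by simp
    next
      case False
      then have "S 1 z \<inter> S i y = {}"
        using neighbour_cases[OF yV zV] d_Y_cases[OF z y] by (fastforce simp: in_S)
      then show ?thesis unfolding eq using False by simp
    qed
  qed
  also have "\<dots> = of_nat (c (i + 1)) * F (i + 1) v z" by (simp only: F_def sum_distrib_left)
  finally show ?thesis .
qed

text \<open>One index of the hypothesis, with the scalars as arguments so that a vanishing \<alpha>
  can be entered as 0.\<close>

definition cond :: "complex \<Rightarrow> complex \<Rightarrow> nat \<Rightarrow> bool" where
  "cond \<alpha> \<beta> i \<longleftrightarrow> (\<forall>y\<in>Y. \<forall>z\<in>S i x. d y z = i \<longrightarrow>
     \<alpha> + \<beta> * of_nat (m (i - 1) y z) = of_nat (card (S (i - 1) x \<inter> S (i - 1) y \<inter> S 1 z)))"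

text \<open>The coefficient of \<open>v y\<close> is evaluated for each of the three possible values
  of \<open>d y z\<close>. It always splits off \<beta> times \<open>m (i + 2) y z\<close>, and that
  part sums to 0 by \<open>sum_m_W\<close>.\<close>

lemma F_raise_zero:
  assumes z: "z \<in> S (i + 3) x" and cond: "cond \<alpha> \<beta> (i + 3)" and v: "v \<in> W"
  shows "(\<Sum>u\<in>S 1 z \<inter> S (i + 2) x. F (i + 2) v u) = \<alpha> * F (i + 3) v z
    + (of_nat (c (i + 3)) - of_nat (c (i + 1)) - \<beta> * of_nat (c 2)) * F (i + 1) v z"
proof -
  have zV: "z \<in> V" and xz: "d x z = i + 3" using z by (simp_all add: in_S)
  have "(\<Sum>u\<in>S 1 z \<inter> S (i + 2) x. F (i + 2) v u)
      = (\<Sum>y\<in>Y. of_nat (card {u\<in>S 1 z \<inter> S (i + 2) x. d y u = i + 2}) * v y)"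
    by (simp add: sum_F)
  also have "\<dots> = (\<Sum>y\<in>Y. \<alpha> * (of_bool (d y z = i + 3) * v y)
    + (of_nat (c (i + 3)) - of_nat (c (i + 1)) - \<beta> * of_nat (c 2)) * (of_bool (d y z = i + 1) * v y)
    + \<beta> * (of_nat (m (i + 2) y z) * v y))"
  proof (intro sum.cong refl)
    fix y assume y: "y \<in> Y"
    then have yV: "y \<in> V" and xy: "d x y = 2" by (simp_all add: in_Y)
    have eq: "{u\<in>S 1 z \<inter> S (i + 2) x. d y u = i + 2} = S (i + 2) x \<inter> S (i + 2) y \<inter> S 1 z"
      by (auto simp: in_S)
    consider "d y z = i + 1" | "d y z = i + 3" | "d y z = i + 5"
      using d_Y_cases[OF z y] by linarith
    then have "of_nat (card (S (i + 2) x \<inter> S (i + 2) y \<inter> S 1 z)) = \<alpha> * of_bool (d y z = i + 3)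
      + (of_nat (c (i + 3)) - of_nat (c (i + 1)) - \<beta> * of_nat (c 2)) * of_bool (d y z = i + 1)
      + \<beta> * of_nat (m (i + 2) y z)"
    proof cases
      case 1
      \<comment> \<open>Of the \<open>c (i + 3)\<close> lower neighbours of \<open>z\<close>,
        exactly \<open>c (i + 1)\<close> are at distance \<open>i\<close> from \<open>y\<close> and
        the rest at \<open>i + 2\<close>. All \<open>c 2\<close> common neighbours of
        \<open>x\<close> and \<open>y\<close> count in \<open>m\<close>, hence the correction by
        \<beta> times \<open>c 2\<close>.\<close>
      have up: "d x u = i + 2" if u: "u \<in> V" "d y u = i" "d z u = 1" for u
      proof -
        have "d x u \<le> 2 + i" using d_triangle[of x y u] u x_in yV xy by simp
        moreover have "d x u = d x z + 1 \<or> d x z = d x u + 1"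
          using neighbour_cases[of x z u] u x_in zV by simp
        ultimately show ?thesis using xz by auto
      qed
      have "S 1 z \<inter> S (i + 2) x = (S (i + 2) x \<inter> S (i + 2) y \<inter> S 1 z) \<union> (S 1 z \<inter> S i y)"
        using neighbour_cases[OF yV zV] 1 up by (fastforce simp: in_S)
      moreover have "card (\<dots>) = card (S (i + 2) x \<inter> S (i + 2) y \<inter> S 1 z) + card (S 1 z \<inter> S i y)"
        by (rule card_Un_disjoint) (auto simp: in_S)
      moreover have "card (S 1 z \<inter> S (i + 2) x) = c (i + 3)"
        using card_S_c[OF zV x_in, of "i + 2"] xz by (simp add: eval_nat_numeral)
      moreover have "card (S 1 z \<inter> S i y) = c (i + 1)"
        using card_S_c[OF zV yV] 1 by simp
      ultimately have "card (S (i + 2) x \<inter> S (i + 2) y \<inter> S 1 z) + c (i + 1) = c (i + 3)" by simp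
      then have "of_nat (card (S (i + 2) x \<inter> S (i + 2) y \<inter> S 1 z))
          = (of_nat (c (i + 3)) - of_nat (c (i + 1)) :: complex)"
        by (metis add_diff_cancel_right' of_nat_add)
      moreover have "m (i + 2) y z = c 2"
      proof -
        have "w \<in> S (i + 2) z" if "w \<in> S 1 x" "w \<in> S 1 y" for w
        proof -
          have w: "w \<in> V" "d x w = 1" "d y w = 1" using that by (auto simp: in_S)
          have "d z w = d z x + 1 \<or> d z x = d z w + 1" "d z w = d z y + 1 \<or> d z y = d z w + 1"
            using neighbour_cases[of z x w] neighbour_cases[of z y w] w zV yV x_in by auto
          then have "d z w = i + 2"
            using 1 xz d_sym[of y z] d_sym[of x z] yV zV x_in by auto
          then show ?thesis using w by (simp add: in_S)
        qed
        then have "S 1 x \<inter> S 1 y \<inter> S (i + 2) z = S 1 x \<inter> S 1 y" by auto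
        then show ?thesis using card_common[OF y] by (simp add: m_def)
      qed
      ultimately show ?thesis using 1 by simp
    next
      case 2
      then show ?thesis using cond y z by (simp add: cond_def)
    next
      case 3
      have "S (i + 2) y \<inter> S 1 z = {}"
        using neighbour_cases[OF yV zV] 3 by (fastforce simp: in_S)
      moreover have "S 1 y \<inter> S (i + 2) z = {}"
        using neighbour_cases[OF zV yV] 3 d_sym[OF yV zV] by (fastforce simp: in_S)
      ultimately have "S (i + 2) x \<inter> S (i + 2) y \<inter> S 1 z = {}" "S 1 x \<inter> S 1 y \<inter> S (i + 2) z = {}"
        by auto
      then show ?thesis using 3 by (simp add: m_def)
    qed
    then show "of_nat (card {u\<in>S 1 z \<inter> S (i + 2) x. d y u = i + 2}) * v y
        = \<alpha> * (of_bool (d y z = i + 3) * v y)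
        + (of_nat (c (i + 3)) - of_nat (c (i + 1)) - \<beta> * of_nat (c 2)) * (of_bool (d y z = i + 1) * v y)
        + \<beta> * (of_nat (m (i + 2) y z) * v y)"
      unfolding eq by (simp only: distrib_right mult.assoc)
  qed
  also have "\<dots> = \<alpha> * F (i + 3) v z
    + (of_nat (c (i + 3)) - of_nat (c (i + 1)) - \<beta> * of_nat (c 2)) * F (i + 1) v z
    + \<beta> * (\<Sum>y\<in>Y. of_nat (m (i + 2) y z) * v y)"
    by (simp only: sum.distrib sum_distrib_left[symmetric] F_def)
  finally show ?thesis using sum_m_W[OF v zV] by simp
qed

section \<open>Injectivity where \<alpha> vanishes\<close>

lemma F_neighbour_split:
  assumes z: "z \<in> S (i + 1) x"
  shows "(\<Sum>u\<in>S 1 z. F j v u) = (\<Sum>u\<in>S 1 z \<inter> S i x. F j v u) + (\<Sum>u\<in>S 1 z \<inter> S (i + 2) x. F j v u)"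
proof -
  have "S 1 z = (S 1 z \<inter> S i x) \<union> (S 1 z \<inter> S (i + 2) x)"
    using neighbour_cases[of x z] z x_in by (fastforce simp: in_S)
  moreover have "(S 1 z \<inter> S i x) \<inter> (S 1 z \<inter> S (i + 2) x) = {}" by (auto simp: in_S)
  ultimately show ?thesis
    by (metis (no_types, lifting) finite_Int finite_S sum.union_disjoint)
qed

text \<open>A vector killed by the distance-\<open>D\<close> matrix vanishes: the three-term recurrence for the distance
  matrices can be run downwards from \<open>D\<close>.\<close>

lemma F_D_injective:
  assumes "\<And>z. z \<in> V \<Longrightarrow> F D v z = 0" and "y \<in> Y"
  shows "v y = 0"
proof -
  \<comment> \<open>Two consecutive indices are carried along, starting from
    \<open>F (D + 1) v = 0\<close>, since no distance exceeds \<open>D\<close>. Each step down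
    divides by some \<open>b j\<close> with \<open>j < D\<close>, which is positive.\<close>
  have "(\<forall>z\<in>V. F (D - i) v z = 0) \<and> (\<forall>z\<in>V. F (D - i + 1) v z = 0)" if "i \<le> D" for i
    using that
  proof (induction i)
    case 0
    then show ?case using assms(1) F_eq_0_of_far by simp
  next
    case (Suc i)
    then have i: "i < D" and eq: "D - i = D - Suc i + 1" by auto
    have IH: "F (D - Suc i + 1) v z = 0" "F (D - Suc i + 2) v z = 0" if "z \<in> V" for z
      using Suc that eq by auto
    have "F (D - Suc i) v z = 0" if "z \<in> V" for z
    proof -
      have "(\<Sum>u\<in>S 1 z. F (D - Suc i + 1) v u) = 0"
        using IH S_subset by (intro sum.neutral) blast
      then have "of_nat (b (D - Suc i)) * F (D - Suc i) v z = 0"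
        using sum_F_neighbours[OF that, of "D - Suc i" v] IH(2)[OF that] by simp
      then show ?thesis using b_pos[of "D - Suc i"] i by simp
    qed
    then show ?case using IH by blast
  qed
  from this[of D] have "F 0 v y = 0" using assms(2) by (simp add: in_Y)
  then show ?thesis using F_0 assms(2) by simp
qed

lemma c_pos_sphere: "z \<in> S (i + 1) x \<Longrightarrow> c (i + 1) > 0"
  using c_pos[of z x i] x_in by (simp add: in_S)

text \<open>Vanishing spreads outwards from sphere \<open>i + 3\<close>: raising handles the
  smallest distance, and \<alpha> = 0 starts an induction for the middle one. Then
  \<open>F D v\<close> vanishes everywhere.\<close>

lemma plus_injective:
  assumes v: "v \<in> W" and cond: "cond 0 \<beta> (i + 3)" and i: "i + 5 \<le> D"
    and zero: "\<And>z. z \<in> S (i + 3) x \<Longrightarrow> F (i + 1) v z = 0" and y: "y \<in> Y"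
  shows "v y = 0"
proof (rule F_D_injective[OF _ y])
  have plus: "F (i + j + 1) v z = 0" if "z \<in> S (i + j + 3) x" for j z
    using that
  proof (induction j arbitrary: z)
    case 0
    then show ?case using zero by simp
  next
    case (Suc j)
    have "(\<Sum>u\<in>S 1 z \<inter> S (i + j + 1 + 2) x. F (i + j + 1) v u) = 0"
      using Suc.IH by (intro sum.neutral) (auto simp: eval_nat_numeral)
    then have "of_nat (c (i + j + 2)) * F (i + j + 2) v z = 0"
      using F_raise_plus[of z "i + j + 1" v] Suc.prems by (simp add: eval_nat_numeral)
    moreover have "c (i + j + 2) > 0"
      using c_pos'[of "i + j + 1"] Suc.prems d_le_D[of x z] x_in by (simp add: in_S)
    ultimately show ?case by simp
  qed
  have mid: "F (i + j + 3) v z = 0" if "z \<in> S (i + j + 3) x" for j z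
    using that
  proof (induction j arbitrary: z)
    case 0
    then have z: "z \<in> S (i + 3) x" and zV: "z \<in> V" by (simp_all add: in_S)
    \<comment> \<open>Lower neighbours contribute 0 since in \<open>F_raise_zero\<close> the first
      coefficient is 0 and the second sum vanishes. At upper neighbours \<open>F (i + 2) v\<close>
      is the sum of smallest distance, covered by \<open>plus\<close>.\<close>
    have "(\<Sum>u\<in>S 1 z. F (i + 2) v u) = 0"
    proof -
      have "(\<Sum>u\<in>S 1 z \<inter> S (i + 2) x. F (i + 2) v u) = 0"
        using F_raise_zero[OF z cond v] plus[of z 0] z by simp
      moreover have "(\<Sum>u\<in>S 1 z \<inter> S (i + 4) x. F (i + 2) v u) = 0"
        using plus[of _ 1] by (intro sum.neutral) (auto simp: eval_nat_numeral)
      ultimately show ?thesis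
        using F_neighbour_split[of z "i + 2" "i + 2" v] z by (simp add: eval_nat_numeral)
    qed
    then have "of_nat (c (i + 3)) * F (i + 3) v z = 0"
      using sum_F_neighbours[OF zV, of "i + 1" v] plus[of z 0] z by (simp add: eval_nat_numeral)
    then show ?case using c_pos_sphere[of z "i + 2"] z by (simp add: eval_nat_numeral)
  next
    case (Suc j)
    then have z: "z \<in> S (i + j + 4) x" and zV: "z \<in> V" by (simp_all add: in_S eval_nat_numeral)
    have "(\<Sum>u\<in>S 1 z. F (i + j + 3) v u) = 0"
    proof -
      have "(\<Sum>u\<in>S 1 z \<inter> S (i + j + 3) x. F (i + j + 3) v u) = 0"
        using Suc.IH by (intro sum.neutral) auto
      moreover have "(\<Sum>u\<in>S 1 z \<inter> S (i + j + 5) x. F (i + j + 3) v u) = 0"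
        using plus[of _ "j + 2"] by (intro sum.neutral) (auto simp: eval_nat_numeral)
      ultimately show ?thesis
        using F_neighbour_split[of z "i + j + 3" "i + j + 3" v] z by (simp add: eval_nat_numeral)
    qed
    then have "of_nat (c (i + j + 4)) * F (i + j + 4) v z = 0"
      using sum_F_neighbours[OF zV, of "i + j + 2" v] plus[of z "j + 1"] z
      by (simp add: eval_nat_numeral)
    then show ?case using c_pos_sphere[of z "i + j + 3"] z by (simp add: eval_nat_numeral)
  qed
  fix z assume z: "z \<in> V"
  show "F D v z = 0"
  proof (cases "i + 3 \<le> d x z")
    case True
    define j where "j = d x z - (i + 3)"
    have zj: "z \<in> S (i + j + 3) x" using True z by (simp add: in_S j_def)
    have 1: "F (i + j + 1) v z = 0" "F (i + j + 3) v z = 0" using plus[OF zj] mid[OF zj] .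
    then have 2: "F (i + j + 5) v z = 0"
      using F_sum_zero[OF v zj] by (simp add: eval_nat_numeral)
    show ?thesis
    proof (cases "D \<in> {i + j + 1, i + j + 3, i + j + 5}")
      case True
      then show ?thesis using 1 2 by auto
    next
      case False
      then have "d y z \<noteq> D" if "y \<in> Y" for y
        using d_Y_cases[OF zj that] by auto
      then show ?thesis by (auto simp: F_def intro!: sum.neutral)
    qed
  next
    case False
    \<comment> \<open>Here \<open>d y z \<le> 2 + d x z < i + 5 \<le> D\<close>, so no
      \<open>y\<close> contributes.\<close>
    have "d y z \<noteq> D" if "y \<in> Y" for y
      using d_triangle[of y x z] that False i x_in z d_sym[of x y] by (auto simp: in_Y)
    then show ?thesis by (auto simp: F_def intro!: sum.neutral)
  qed
qed

section \<open>The local adjacency operator on \<open>W\<close>\<close>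

text \<open>These are the entries of \<open>N B\<close>. If \<open>y\<close> is adjacent to
  \<open>w\<close>, all neighbours of \<open>w\<close> except \<open>x\<close> and \<open>y\<close>
  qualify; otherwise \<open>d y w = 3\<close>, and of the \<open>c 3\<close> neighbours of
  \<open>w\<close> at distance 2 from \<open>y\<close> only \<open>x\<close> is lost.\<close>

lemma card_B_N:
  assumes w: "w \<in> S 1 x" and y: "y \<in> Y"
  shows "of_nat (card {y'\<in>Y. d y y' = 2 \<and> d y' w = 1})
    = (if d y w = 1 then of_nat k - 2 else of_nat (c 3) - 1 :: complex)"
proof -
  have wV: "w \<in> V" "d x w = 1" and yV: "y \<in> V" "d x y = 2" using w y by (simp_all add: in_S in_Y)
  have nb: "d y' w = d w y'" if "y' \<in> V" for y' using d_sym that wV by blast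
  show ?thesis
  proof (cases "d y w = 1")
    case True
    have xy: "x \<noteq> y" using yV x_in by auto
    have "{y'\<in>Y. d y y' = 2 \<and> d y' w = 1} = S 1 w - {x, y}"
    proof (intro equalityI subsetI)
      fix y' assume "y' \<in> S 1 w - {x, y}"
      then have y': "y' \<in> V" "d w y' = 1" "y' \<noteq> x" "y' \<noteq> y" by (auto simp: in_S)
      have "d x y' \<noteq> 0" "d y y' \<noteq> 0" using d_eq_0 x_in yV y' by auto
      moreover have "d x y' = d x w + 1 \<or> d x w = d x y' + 1" "d y y' = d y w + 1 \<or> d y w = d y y' + 1"
        using neighbour_cases[of x w y'] neighbour_cases[of y w y'] x_in yV wV y' by auto
      ultimately show "y' \<in> {y'\<in>Y. d y y' = 2 \<and> d y' w = 1}"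
        using True wV y' nb by (auto simp: in_Y)
    qed (use x_in yV nb in \<open>auto simp: in_Y in_S\<close>)
    moreover have "x \<in> S 1 w" "y \<in> S 1 w"
      using x_in wV yV True d_sym[of x w] d_sym[of y w] by (auto simp: in_S)
    ultimately have "card {y'\<in>Y. d y y' = 2 \<and> d y' w = 1} = k - 2"
      using xy card_S_1[of w] wV by (simp add: card_Diff_subset)
    then show ?thesis using True k_ge by simp
  next
    case False
    then have 3: "d y w = 3"
      using neighbour_cases[of y x w] yV wV x_in d_sym[of x y] by auto
    have "{y'\<in>Y. d y y' = 2 \<and> d y' w = 1} = S 1 w \<inter> S 2 y - {x}"
    proof (intro equalityI subsetI)
      fix y' assume "y' \<in> S 1 w \<inter> S 2 y - {x}"
      then have y': "y' \<in> V" "d w y' = 1" "y' \<noteq> x" "d y y' = 2" by (auto simp: in_S)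
      have "d x y' \<noteq> 0" using d_eq_0 x_in yV y' by auto
      moreover have "d x y' = d x w + 1 \<or> d x w = d x y' + 1"
        using neighbour_cases[of x w y'] x_in yV wV y' by auto
      ultimately show "y' \<in> {y'\<in>Y. d y y' = 2 \<and> d y' w = 1}"
        using wV y' nb by (auto simp: in_Y)
    qed (use x_in yV nb in \<open>auto simp: in_Y in_S\<close>)
    moreover have x: "x \<in> S 1 w \<inter> S 2 y"
      using x_in wV yV d_sym[of x w] d_sym[of x y] by (auto simp: in_S)
    moreover have c3: "card (S 1 w \<inter> S 2 y) = c 3"
      using card_S_c[of w y 2] wV yV 3 by simp
    ultimately have "card {y'\<in>Y. d y y' = 2 \<and> d y' w = 1} = c 3 - 1"
      by simp
    moreover have "c 3 > 0" using c3 x by (metis card_gt_0_iff finite_Int finite_S empty_iff)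
    ultimately show ?thesis using False by (simp add: of_nat_diff)
  qed
qed

text \<open>By \<open>card_B_N\<close>, \<open>N B\<close> is a combination of \<open>N\<close> and
  the all-ones matrix, and both kill \<open>W\<close>.\<close>

lemma W_invariant:
  assumes v: "v \<in> W"
  shows "F 2 v \<in> W"
  unfolding W_def
proof (intro CollectI ballI)
  fix w assume w: "w \<in> S 1 x"
  then have nb: "y \<in> Y \<Longrightarrow> y \<in> S 1 w \<longleftrightarrow> d y w = 1" for y
    using d_sym[of y w] by (simp add: in_S in_Y)
  have "F 1 (F 2 v) w = (\<Sum>y'\<in>Y \<inter> S 1 w. F 2 v y')"
  proof -
    have "F 1 (F 2 v) w = (\<Sum>y'\<in>Y. if y' \<in> S 1 w then F 2 v y' else 0)"
      unfolding F_def[of 1]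
    proof (intro sum.cong refl)
      fix y' assume "y' \<in> Y"
      from nb[OF this] show "of_bool (d y' w = 1) * F 2 v y' = (if y' \<in> S 1 w then F 2 v y' else 0)"
        by simp
    qed
    then show ?thesis by (simp add: sum.inter_restrict)
  qed
  also have "\<dots> = (\<Sum>y\<in>Y. of_nat (card {y'\<in>Y. d y y' = 2 \<and> d y' w = 1}) * v y)"
  proof -
    have "{y'\<in>Y \<inter> S 1 w. d y y' = 2} = {y'\<in>Y. d y y' = 2 \<and> d y' w = 1}" for y
      using nb by blast
    then show ?thesis by (simp add: sum_F)
  qed
  also have "\<dots> = (\<Sum>y\<in>Y. (of_nat k - 1 - of_nat (c 3)) * (of_bool (d y w = 1) * v y)
      + (of_nat (c 3) - 1) * v y)"
  proof (intro sum.cong refl)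
    fix y assume "y \<in> Y"
    from card_B_N[OF w this] show "of_nat (card {y'\<in>Y. d y y' = 2 \<and> d y' w = 1}) * v y
        = (of_nat k - 1 - of_nat (c 3)) * (of_bool (d y w = 1) * v y) + (of_nat (c 3) - 1) * v y"
      by (simp only: of_bool_def split: if_split) (simp add: algebra_simps)
  qed
  also have "\<dots> = (of_nat k - 1 - of_nat (c 3)) * F 1 v w + (of_nat (c 3) - 1) * (\<Sum>y\<in>Y. v y)"
    by (simp only: sum.distrib sum_distrib_left F_def)
  also have "\<dots> = 0" using v w sum_W[OF v] by (simp add: W_def)
  finally show "F 1 (F 2 v) w = 0" .
qed

lemma W_linear: "v \<in> W \<Longrightarrow> v' \<in> W \<Longrightarrow> (\<lambda>y. r * v y + t * v' y) \<in> W"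
  by (simp add: W_def F_linear)

lemma F_F2_2: "z \<in> S 2 x \<Longrightarrow> F 2 v z = F 0 (F 2 v) z"
  using F_0[of z "F 2 v"] by (simp add: Y_def)

text \<open>Raising the relation at sphere \<open>i + 2\<close> gives one at \<open>i + 3\<close>,
  which can be solved for \<open>F (i + 3) v\<close> because \<alpha> is nonzero there. The scalars
  \<open>r\<close> and \<open>s\<close> serve all \<open>v\<close> and \<open>z\<close> at
  once.\<close>

lemma F_zero_from_plus:
  assumes "\<And>j. j < i \<Longrightarrow> cond (\<alpha> (j + 3)) (\<beta> (j + 3)) (j + 3)"
    and "\<And>j. j < i \<Longrightarrow> \<alpha> (j + 3) \<noteq> 0" and "i + 2 \<le> D"
  shows "\<exists>r s. r \<noteq> 0 \<and> (\<forall>v\<in>W. \<forall>z\<in>S (i + 2) x. F (i + 2) v z = r * F i (F 2 v) z + s * F i v z)"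
  using assms
proof (induction i)
  case 0
  have "1 \<noteq> (0 :: complex) \<and> (\<forall>v\<in>W. \<forall>z\<in>S (0 + 2) x. F (0 + 2) v z = 1 * F 0 (F 2 v) z + 0 * F 0 v z)"
    using F_F2_2 unfolding add_0 by simp
  then show ?case by blast
next
  case (Suc i)
  have "\<exists>r s. r \<noteq> 0 \<and> (\<forall>v\<in>W. \<forall>z\<in>S (i + 2) x. F (i + 2) v z = r * F i (F 2 v) z + s * F i v z)"
    by (rule Suc.IH[OF Suc.prems(1)[OF less_SucI] Suc.prems(2)[OF less_SucI]])
       (use Suc.prems(3) in simp_all)
  then obtain r s where "r \<noteq> 0"
    and IH: "\<And>v z. v \<in> W \<Longrightarrow> z \<in> S (i + 2) x \<Longrightarrow> F (i + 2) v z = r * F i (F 2 v) z + s * F i v z"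
    by blast
  let ?\<alpha> = "\<alpha> (i + 3)" and ?c = "of_nat (c (i + 1)) :: complex"
  let ?\<kappa> = "of_nat (c (i + 3)) - of_nat (c (i + 1)) - \<beta> (i + 3) * of_nat (c 2) :: complex"
  have "?\<alpha> \<noteq> 0" using Suc.prems by simp
  have "F (i + 3) v z = r * ?c / ?\<alpha> * F (i + 1) (F 2 v) z + (s * ?c - ?\<kappa>) / ?\<alpha> * F (i + 1) v z"
    if v: "v \<in> W" and z: "z \<in> S (i + 3) x" for v z
  proof -
    have "?\<alpha> * F (i + 3) v z + ?\<kappa> * F (i + 1) v z = (\<Sum>u\<in>S 1 z \<inter> S (i + 2) x. F (i + 2) v u)"
      using F_raise_zero[OF z _ v] Suc.prems(1)[of i] by simp
    also have "\<dots> = (\<Sum>u\<in>S 1 z \<inter> S (i + 2) x. r * F i (F 2 v) u + s * F i v u)"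
      using IH v by (intro sum.cong refl) auto
    also have "\<dots> = r * (?c * F (i + 1) (F 2 v) z) + s * (?c * F (i + 1) v z)"
      by (simp only: sum.distrib sum_distrib_left[symmetric] F_raise_plus[OF z])
    finally show ?thesis using \<open>?\<alpha> \<noteq> 0\<close> by (simp add: field_simps)
  qed
  \<comment> \<open>The coefficient of \<open>F 2 v\<close> must survive, as
    \<open>local_scalar\<close> divides by it.\<close>
  moreover have "r * ?c / ?\<alpha> \<noteq> 0"
    using \<open>r \<noteq> 0\<close> \<open>?\<alpha> \<noteq> 0\<close> c_pos'[of i] Suc.prems(3) by simp
  ultimately have "\<exists>r s. r \<noteq> 0 \<and> (\<forall>v\<in>W. \<forall>z\<in>S (i + 3) x. F (i + 3) v z = r * F (i + 1) (F 2 v) z + s * F (i + 1) v z)"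
    by blast
  moreover have "Suc i + 2 = i + 3" "Suc i = i + 1" by simp_all
  ultimately show ?case by (simp only:)
qed

lemma local_scalar:
  assumes cond: "\<And>i. 3 \<le> i \<Longrightarrow> i + 2 \<le> D \<Longrightarrow> cond (\<alpha> i) (\<beta> i) i"
    and zero: "3 \<le> i0" "i0 + 2 \<le> D" "\<alpha> i0 = 0"
  shows "\<exists>\<eta>. \<forall>v\<in>W. \<forall>y\<in>Y. F 2 v y = \<eta> * v y"
proof -
  \<comment> \<open>At the least zero of \<alpha>, with indices shifted by 3, all earlier scalars
    are nonzero, so \<open>F_zero_from_plus\<close> reaches sphere \<open>i + 2\<close>.\<close>
  define i where "i = (LEAST i. \<alpha> (i + 3) = 0)"
  have ex: "\<alpha> (i0 - 3 + 3) = 0" using zero by simp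
  have \<alpha>: "\<alpha> (i + 3) = 0" unfolding i_def using ex by (rule LeastI)
  have "i \<le> i0 - 3" unfolding i_def using ex by (rule Least_le)
  then have i: "i + 5 \<le> D" using zero by simp
  have nonzero: "\<alpha> (j + 3) \<noteq> 0" if "j < i" for j
    using not_less_Least that unfolding i_def by blast
  obtain r s where "r \<noteq> 0"
    and rs: "\<And>v z. v \<in> W \<Longrightarrow> z \<in> S (i + 2) x \<Longrightarrow> F (i + 2) v z = r * F i (F 2 v) z + s * F i v z"
  proof -
    have "\<exists>r s. r \<noteq> 0 \<and> (\<forall>v\<in>W. \<forall>z\<in>S (i + 2) x. F (i + 2) v z = r * F i (F 2 v) z + s * F i v z)"
      using cond nonzero i by (intro F_zero_from_plus[of i \<alpha> \<beta>]) auto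
    then show thesis using that by blast
  qed
  let ?c = "of_nat (c (i + 1)) :: complex"
  let ?\<kappa> = "of_nat (c (i + 3)) - of_nat (c (i + 1)) - \<beta> (i + 3) * of_nat (c 2) :: complex"
  have c: "cond 0 (\<beta> (i + 3)) (i + 3)" using cond[of "i + 3"] \<alpha> i by simp
  have "?c \<noteq> 0" using c_pos'[of i] i by simp
  have "F 2 v y = (?\<kappa> - s * ?c) / (r * ?c) * v y" if v: "v \<in> W" and y: "y \<in> Y" for v y
  proof -
    \<comment> \<open>Raising once more produces no \<open>F (i + 3) v\<close>, since \<alpha> is 0.
      What remains says exactly that \<open>F (i + 1)\<close> of this combination vanishes on sphere
      \<open>i + 3\<close>, so injectivity applies.\<close>
    let ?v = "\<lambda>y. r * ?c * F 2 v y + (s * ?c - ?\<kappa>) * v y"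
    have "F (i + 1) ?v z = 0" if z: "z \<in> S (i + 3) x" for z
    proof -
      have "?\<kappa> * F (i + 1) v z = (\<Sum>u\<in>S 1 z \<inter> S (i + 2) x. F (i + 2) v u)"
        using F_raise_zero[OF z c v] by simp
      also have "\<dots> = (\<Sum>u\<in>S 1 z \<inter> S (i + 2) x. r * F i (F 2 v) u + s * F i v u)"
        using rs v by (intro sum.cong refl) auto
      also have "\<dots> = r * (?c * F (i + 1) (F 2 v) z) + s * (?c * F (i + 1) v z)"
        by (simp only: sum.distrib sum_distrib_left[symmetric] F_raise_plus[OF z])
      finally show ?thesis unfolding F_linear by (simp add: algebra_simps)
    qed
    then have "?v y = 0"
      using plus_injective[OF W_linear[OF W_invariant[OF v] v] c i _ y] by blast
    then show ?thesis using \<open>r \<noteq> 0\<close> \<open>?c \<noteq> 0\<close> by (simp add: field_simps)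
  qed
  then show ?thesis by blast
qed

section \<open>Products of the incidence matrix\<close>

text \<open>The entries of \<open>N N\<^sup>T\<close>: all common neighbours of \<open>w\<close> and
  \<open>w'\<close> except \<open>x\<close> lie in \<open>Y\<close>, and distinct \<open>w\<close>,
  \<open>w'\<close> are at distance 2.\<close>

lemma card_Y_neighbours:
  assumes w: "w \<in> S 1 x" and w': "w' \<in> S 1 x"
  shows "of_nat (card {y\<in>Y. d y w = 1 \<and> d y w' = 1})
    = (if w = w' then of_nat k - 1 else of_nat (c 2) - 1 :: complex)"
proof -
  have wV: "w \<in> V" "d x w = 1" "w' \<in> V" "d x w' = 1" using w w' by (simp_all add: in_S)
  have nb: "d y w = d w y" "d y w' = d w' y" if "y \<in> V" for y using d_sym that wV by blast+
  have "{y\<in>Y. d y w = 1 \<and> d y w' = 1} = S 1 w \<inter> S 1 w' - {x}"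
  proof (intro equalityI subsetI)
    fix y assume "y \<in> S 1 w \<inter> S 1 w' - {x}"
    then have y: "y \<in> V" "d w y = 1" "d w' y = 1" "y \<noteq> x" by (auto simp: in_S)
    have "d x y \<noteq> 0" using d_eq_0 x_in y by auto
    moreover have "d x y = d x w + 1 \<or> d x w = d x y + 1"
      using neighbour_cases[of x w y] x_in wV y by auto
    ultimately show "y \<in> {y\<in>Y. d y w = 1 \<and> d y w' = 1}"
      using wV y nb[of y] by (auto simp: in_Y)
  next
    fix y assume "y \<in> {y\<in>Y. d y w = 1 \<and> d y w' = 1}"
    then have "y \<in> V" "d x y = 2" "d y w = 1" "d y w' = 1" by (auto simp: in_Y)
    then show "y \<in> S 1 w \<inter> S 1 w' - {x}" using nb[of y] x_in by (auto simp: in_S)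
  qed
  moreover have x: "x \<in> S 1 w \<inter> S 1 w'"
    using x_in wV d_sym[of x w] d_sym[of x w'] by (auto simp: in_S)
  ultimately have *: "card {y\<in>Y. d y w = 1 \<and> d y w' = 1} = card (S 1 w \<inter> S 1 w') - 1"
    by simp
  show ?thesis
  proof (cases "w = w'")
    case True
    then show ?thesis using * card_S_1[of w'] wV k_ge by (simp add: of_nat_diff)
  next
    case False
    then have "d w w' \<noteq> 0" using d_eq_0 wV by blast
    moreover have "d w w' = d w x + 1 \<or> d w x = d w w' + 1"
      using neighbour_cases[of w x w'] wV x_in by auto
    moreover have "d w x = 1" using wV x_in d_sym[of w x] by simp
    ultimately have "d w w' = 1 + 1" by auto
    then have "d w' w = 1 + 1" using wV d_sym[of w' w] by simp
    then have "card (S 1 w \<inter> S 1 w') = c (1 + 1)"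
      using card_S_c[of w w' 1] wV by simp
    then show ?thesis using * False c2_pos by (simp add: of_nat_diff numeral_2_eq_2)
  qed
qed

abbreviation M :: "'a \<Rightarrow> 'a \<Rightarrow> complex" where
  "M y y' \<equiv> of_nat (m 1 y y')"

lemma M_eq_sum:
  "M y y' = (\<Sum>w\<in>S 1 x \<inter> S 1 y. of_bool (d y' w = 1))"
proof -
  have "S 1 x \<inter> S 1 y \<inter> S 1 y' = (S 1 x \<inter> S 1 y) \<inter> {w. d y' w = 1}" by (auto simp: in_S)
  then show ?thesis by (simp add: m_def)
qed

lemma M_self: "y \<in> Y \<Longrightarrow> M y y = of_nat (c 2)"
  using card_common by (simp add: m_def Int_assoc)

text \<open>An entry of \<open>N N\<^sup>T N\<close>, bracketed so that \<open>N N\<^sup>T\<close>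
  is taken from \<open>card_Y_neighbours\<close>.\<close>

lemma sum_M_neighbours:
  assumes w: "w \<in> S 1 x" and y: "y \<in> Y"
  shows "(\<Sum>y'\<in>Y. of_bool (d y' w = 1) * M y y') = (of_nat (c 2) - 1) * of_nat (c 2)
    + of_bool (d y w = 1) * (of_nat k - of_nat (c 2))"
proof -
  have "(\<Sum>y'\<in>Y. of_bool (d y' w = 1) * M y y')
      = (\<Sum>w'\<in>S 1 x \<inter> S 1 y. \<Sum>y'\<in>Y. of_bool (d y' w = 1 \<and> d y' w' = 1))"
    unfolding M_eq_sum sum_distrib_left
    by (subst sum.swap) (intro sum.cong refl, simp)
  also have "\<dots> = (\<Sum>w'\<in>S 1 x \<inter> S 1 y. of_nat (card {y'\<in>Y. d y' w = 1 \<and> d y' w' = 1}))"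
    by (intro sum.cong refl) (simp add: Int_def)
  also have "\<dots> = (\<Sum>w'\<in>S 1 x \<inter> S 1 y. (of_nat (c 2) - 1) + (if w = w' then of_nat k - of_nat (c 2) else 0))"
    by (intro sum.cong refl) (use card_Y_neighbours[OF w] in simp)
  also have "\<dots> = (of_nat (c 2) - 1) * of_nat (c 2) + of_bool (d y w = 1) * (of_nat k - of_nat (c 2))"
    using w y card_common[OF y] by (simp add: sum.distrib sum.delta in_S)
  finally show ?thesis .
qed

text \<open>An entry of \<open>B N\<^sup>T N\<close>, with the factor \<open>B N\<^sup>T\<close>
  taken from \<open>card_B_N\<close>.\<close>

lemma sum_M_distance_2:
  assumes y: "y \<in> Y" and z: "z \<in> Y"
  shows "(\<Sum>y'\<in>Y. of_bool (d y' z = 2) * M y y')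
    = M y z * (of_nat k - 1 - of_nat (c 3)) + of_nat (c 2) * (of_nat (c 3) - 1)"
proof -
  have sym: "d y' z = d z y'" if "y' \<in> Y" for y' using d_sym[of y' z] that z by (simp add: in_Y)
  have "(\<Sum>y'\<in>Y. of_bool (d y' z = 2) * M y y')
      = (\<Sum>w\<in>S 1 x \<inter> S 1 y. \<Sum>y'\<in>Y. of_bool (d z y' = 2 \<and> d y' w = 1))"
    unfolding M_eq_sum sum_distrib_left
    by (subst sum.swap) (intro sum.cong refl, simp add: sym)
  also have "\<dots> = (\<Sum>w\<in>S 1 x \<inter> S 1 y. of_nat (card {y'\<in>Y. d z y' = 2 \<and> d y' w = 1}))"
    by (intro sum.cong refl) (simp add: Int_def)
  also have "\<dots> = (\<Sum>w\<in>S 1 x \<inter> S 1 y. of_bool (d z w = 1) * (of_nat k - 1 - of_nat (c 3)) + (of_nat (c 3) - 1))"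
  proof (intro sum.cong refl)
    fix w assume "w \<in> S 1 x \<inter> S 1 y"
    then show "of_nat (card {y'\<in>Y. d z y' = 2 \<and> d y' w = 1})
        = (of_bool (d z w = 1) * (of_nat k - 1 - of_nat (c 3)) + (of_nat (c 3) - 1) :: complex)"
      using card_B_N[of w z] z by simp
  qed
  also have "\<dots> = M y z * (of_nat k - 1 - of_nat (c 3)) + of_nat (c 2) * (of_nat (c 3) - 1)"
    by (simp only: sum.distrib sum_distrib_right M_eq_sum sum_constant card_common[OF y])
  finally show ?thesis .
qed

lemma card_Y_neighbours_1:
  "w \<in> S 1 x \<Longrightarrow> of_nat (card {y\<in>Y. d y w = 1}) = (of_nat k - 1 :: complex)"
  using card_Y_neighbours[of w w] by simp

lemma card_Y_distance:
  "z \<in> Y \<Longrightarrow> card {y\<in>Y. d y z = j} = p 2 2 j"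
proof -
  assume z: "z \<in> Y"
  then have "d y z = d z y" if "y \<in> V" for y using d_sym[of y z] that by (simp add: in_Y)
  then have "{y\<in>Y. d y z = j} = S 2 x \<inter> S j z" by (auto simp: in_Y in_S)
  then show ?thesis using card_S_Int[of x z 2 j] z x_in by (simp add: in_Y)
qed

lemma M_far: "y \<in> Y \<Longrightarrow> z \<in> Y \<Longrightarrow> d y z \<noteq> 0 \<Longrightarrow> d y z \<noteq> 2 \<Longrightarrow> M y z = 0"
  unfolding m_def
proof -
  assume y: "y \<in> Y" and z: "z \<in> Y" and *: "d y z \<noteq> 0" "d y z \<noteq> 2"
  have "w \<notin> S 1 z" if "w \<in> S 1 y" for w
  proof
    assume w: "w \<in> S 1 z"
    then have "d y w = d y z + 1 \<or> d y z = d y w + 1"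
      using neighbour_cases[of y z w] y z by (auto simp: in_S in_Y)
    then show False using * that by (auto simp: in_S)
  qed
  then have "S 1 x \<inter> S 1 y \<inter> S 1 z = {}" by auto
  then show "of_nat (card (S 1 x \<inter> S 1 y \<inter> S 1 z)) = 0" by simp
qed

text \<open>Some sphere of radius \<open>i\<close> is nonempty, and its size \<open>p 0 i i\<close>
  is the same at every vertex.\<close>

lemma sphere_nonempty:
  assumes "i \<le> D" "z \<in> V"
  shows "S i z \<noteq> {}"
proof -
  obtain u v where uv: "u \<in> V" "v \<in> V" "d u v = i" using pair_exists[OF assms(1)] .
  then have "v \<in> S i u" by (simp add: in_S)
  then have "card (S i u) > 0" by (auto simp: card_gt_0_iff)
  then have "p 0 i i > 0" using card_S_Int[of u u i i] uv by simp
  then have "card (S i z) > 0" using card_S_Int[of z z i i] assms(2) by simp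
  then show ?thesis by auto
qed

lemma k_gt_c2: "c 2 < k"
proof -
  obtain u v where "u \<in> V" "v \<in> V" "d u v = 2" using pair_exists[of 2] D_ge by auto
  then have "b 2 + c 2 = k" using b_plus_c[of v u 1] by (simp add: numeral_2_eq_2)
  then show ?thesis using b_pos[of 2] D_ge by simp
qed

text \<open>The vector used here is \<open>k - c 2\<close> times the projection of the indicator of \<open>y\<close> to \<open>W\<close>.\<close>

lemma M_constant:
  assumes \<eta>: "\<And>v y. v \<in> W \<Longrightarrow> y \<in> Y \<Longrightarrow> F 2 v y = \<eta> * v y"
  shows "\<exists>\<gamma>. \<forall>y\<in>Y. \<forall>z\<in>Y. M y z = of_nat (c 2) * of_bool (d y z = 0) + \<gamma> * of_bool (d y z = 2)"
proof -
  \<comment> \<open>Each \<open>w\<close> in \<open>S 1 x\<close> has \<open>k - 1\<close>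
    neighbours in \<open>Y\<close>, so this \<open>s\<close> cancels the constant
    \<open>c 2 * (c 2 - 1)\<close> of \<open>sum_M_neighbours\<close>.\<close>
  define s :: complex where "s = of_nat (c 2) * (of_nat (c 2) - 1) / (of_nat k - 1)"
  define v where "v y z = (of_nat k - of_nat (c 2)) * of_bool (z = y) - M y z + s" for y z
  have k1: "of_nat k - 1 \<noteq> (0 :: complex)" using k_ge by (auto simp: of_nat_eq_1_iff)
  have kc: "of_nat k - of_nat (c 2) \<noteq> (0 :: complex)" using k_gt_c2 by simp
  have vW: "v y \<in> W" if y: "y \<in> Y" for y
    unfolding W_def
  proof (intro CollectI ballI)
    fix w assume w: "w \<in> S 1 x"
    have "F 1 (v y) w = (\<Sum>z\<in>Y. (if z = y then of_bool (d y w = 1) * (of_nat k - of_nat (c 2)) else 0)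
        - of_bool (d z w = 1) * M y z + of_bool (d z w = 1) * s)"
      unfolding F_def v_def by (intro sum.cong refl) (simp add: algebra_simps)
    also have "\<dots> = of_bool (d y w = 1) * (of_nat k - of_nat (c 2))
        - (\<Sum>z\<in>Y. of_bool (d z w = 1) * M y z) + of_nat (card {z\<in>Y. d z w = 1}) * s"
      unfolding sum.distrib sum_subtractf sum_distrib_right[symmetric]
      using y by (simp add: Int_def)
    also have "\<dots> = 0"
      unfolding sum_M_neighbours[OF w y] card_Y_neighbours_1[OF w] s_def using k1 by simp
    finally show "F 1 (v y) w = 0" .
  qed
  have F2v: "F 2 (v y) z = of_bool (d y z = 2) * (of_nat k - of_nat (c 2))
      - (M y z * (of_nat k - 1 - of_nat (c 3)) + of_nat (c 2) * (of_nat (c 3) - 1))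
      + of_nat (p 2 2 2) * s" if y: "y \<in> Y" and z: "z \<in> Y" for y z
  proof -
    have "F 2 (v y) z = (\<Sum>y'\<in>Y. (if y' = y then of_bool (d y z = 2) * (of_nat k - of_nat (c 2)) else 0)
        - of_bool (d y' z = 2) * M y y' + of_bool (d y' z = 2) * s)"
      unfolding F_def v_def by (intro sum.cong refl) (simp add: algebra_simps)
    also have "\<dots> = of_bool (d y z = 2) * (of_nat k - of_nat (c 2))
        - (\<Sum>y'\<in>Y. of_bool (d y' z = 2) * M y y') + of_nat (card {y'\<in>Y. d y' z = 2}) * s"
      unfolding sum.distrib sum_subtractf sum_distrib_right[symmetric]
      using y by (simp add: Int_def)
    finally show ?thesis unfolding sum_M_distance_2[OF y z] card_Y_distance[OF z] .
  qed
  define q where "q = of_nat k - 1 - of_nat (c 3) - \<eta>"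
  \<comment> \<open>At distance 4 the entries of \<open>M\<close> and \<open>B\<close> vanish, so
    the eigenvalue equation relates only the constant terms. They then cancel for pairs at distance
    2, leaving an equation that forces the same \<open>M y z\<close> for all of them.\<close>
  obtain y0 z0 where 0: "y0 \<in> Y" "z0 \<in> Y" "d y0 z0 = 4"
  proof -
    obtain y0 where y0: "y0 \<in> Y" using sphere_nonempty[of 2 x] D_ge x_in by (auto simp: Y_def)
    then have "card (S 2 x \<inter> S 4 y0) = p 2 2 4"
      using card_S_Int[of x y0 2 4] x_in by (simp add: in_Y)
    then have "S 2 x \<inter> S 4 y0 \<noteq> {}" using p_pos[of 2 2] D_ge by auto
    then obtain z0 where "z0 \<in> S 2 x" "z0 \<in> S 4 y0" by blast
    then show thesis using that[of y0 z0] y0 by (simp add: in_Y in_S)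
  qed
  have "z0 \<noteq> y0" using 0 by (auto simp: in_Y)
  then have far: "of_nat (p 2 2 2) * s - of_nat (c 2) * (of_nat (c 3) - 1) = \<eta> * s"
    using F2v[OF 0(1,2)] \<eta>[OF vW[OF 0(1)] 0(2)] M_far[OF 0(1,2)] 0 by (simp add: v_def)
  have M2: "M y z * q = of_nat k - of_nat (c 2)" if y: "y \<in> Y" and z: "z \<in> Y" and 2: "d y z = 2" for y z
  proof -
    have "z \<noteq> y" using y 2 by (auto simp: in_Y)
    then have "of_nat k - of_nat (c 2) - M y z * (of_nat k - 1 - of_nat (c 3))
        + (of_nat (p 2 2 2) * s - of_nat (c 2) * (of_nat (c 3) - 1)) = \<eta> * (s - M y z)"
      using F2v[OF y z] \<eta>[OF vW[OF y] z] 2 by (simp add: v_def algebra_simps)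
    then show ?thesis unfolding far q_def by (simp add: algebra_simps)
  qed
  have "M y z = of_nat (c 2) * of_bool (d y z = 0) + (of_nat k - of_nat (c 2)) / q * of_bool (d y z = 2)"
    if y: "y \<in> Y" and z: "z \<in> Y" for y z
  proof -
    consider "d y z = 0" | "d y z = 2" | "d y z \<noteq> 0" "d y z \<noteq> 2" by blast
    then show ?thesis
    proof cases
      case 1
      then have "z = y" using d_eq_0 y z by (auto simp: in_Y)
      then show ?thesis using M_self[OF y] 1 by simp
    next
      case 2
      have "q \<noteq> 0" using M2[OF y z 2] kc by auto
      then show ?thesis using M2[OF y z 2] 2 by (simp add: field_simps)
    next
      case 3
      then show ?thesis using M_far[OF y z] by simp
    qed
  qed
  then show ?thesis by blast
qed

text \<open>Two evaluations of sums of entries of \<open>N\<^sup>TN\<close> in the row of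
  \<open>y\<close> are compared: over all of \<open>Y\<close>, over the neighbours of some
  \<open>w\<close> in \<open>S 1 x\<close> with \<open>d y w = 3\<close>, and of some
  \<open>w\<close> with \<open>d y w = 1\<close>.\<close>

lemma local_parameters:
  assumes M: "\<And>y z. y \<in> Y \<Longrightarrow> z \<in> Y \<Longrightarrow>
      M y z = of_nat (c 2) * of_bool (d y z = 0) + \<gamma> * of_bool (d y z = 2)"
  shows "\<gamma> * of_nat (p 2 2 2) = of_nat (c 2) * (of_nat k - 2)"
    and "\<gamma> * (of_nat (c 3) - 1) = of_nat (c 2) * (of_nat (c 2) - 1)"
    and "\<gamma> * (of_nat k - 2) = of_nat k + of_nat (c 2) ^ 2 - 3 * of_nat (c 2)"
    and "\<gamma> \<noteq> 0"
proof -
  obtain y where y: "y \<in> Y" using sphere_nonempty[of 2 x] D_ge x_in by (auto simp: Y_def)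
  have yV: "y \<in> V" "d x y = 2" "d y x = 2" using y x_in d_sym[of x y] by (auto simp: in_Y)
  have sum_M: "(\<Sum>z\<in>Y. of_bool (P z) * M y z)
      = of_nat (c 2) * of_bool (P y) + \<gamma> * of_nat (card {z\<in>Y. d y z = 2 \<and> P z})" for P
  proof -
    have "(\<Sum>z\<in>Y. of_bool (P z) * M y z)
        = (\<Sum>z\<in>Y. (if z = y then of_nat (c 2) * of_bool (P y) else 0) + \<gamma> * of_bool (d y z = 2 \<and> P z))"
      using M[OF y] d_eq_0 yV by (intro sum.cong refl) (auto simp: in_Y)
    also have "\<dots> = of_nat (c 2) * of_bool (P y) + \<gamma> * of_nat (card {z\<in>Y. d y z = 2 \<and> P z})"
      unfolding sum.distrib sum_distrib_left[symmetric] using y by (simp add: Int_def)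
    finally show ?thesis .
  qed
  have "(\<Sum>z\<in>Y. M y z) = (\<Sum>w\<in>S 1 x \<inter> S 1 y. of_nat (card {z\<in>Y. d z w = 1}))"
    unfolding M_eq_sum by (subst sum.swap) (simp add: Int_def)
  also have "\<dots> = of_nat (c 2) * (of_nat k - 1)"
  proof -
    have "(\<Sum>w\<in>S 1 x \<inter> S 1 y. of_nat (card {z\<in>Y. d z w = 1}))
        = (\<Sum>w\<in>S 1 x \<inter> S 1 y. of_nat k - 1 :: complex)"
      by (intro sum.cong refl card_Y_neighbours_1) blast
    then show ?thesis using card_common[OF y] by simp
  qed
  finally have "of_nat (c 2) + \<gamma> * of_nat (card {z\<in>Y. d y z = 2}) = of_nat (c 2) * (of_nat k - 1)"
    using sum_M[of "\<lambda>_. True"] by simp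
  moreover have "{z\<in>Y. d y z = 2} = {z\<in>Y. d z y = 2}" using d_sym[OF yV(1)] by (auto simp: in_Y)
  ultimately show p222: "\<gamma> * of_nat (p 2 2 2) = of_nat (c 2) * (of_nat k - 2)"
    using card_Y_distance[OF y, of 2] by (simp add: algebra_simps)
  have "of_nat k \<noteq> (of_nat 2 :: complex)" using k_ge unfolding of_nat_eq_iff by simp
  then show "\<gamma> \<noteq> 0" using p222 c2_pos by auto
  obtain w where w: "w \<in> S 1 x" "d y w = 3"
  proof -
    have "card (S 1 x \<inter> S 3 y) = b 2" using card_S_b[of x y 2] x_in yV by simp
    then have "S 1 x \<inter> S 3 y \<noteq> {}" using b_pos[of 2] D_ge by auto
    then obtain w where "w \<in> S 1 x" "w \<in> S 3 y" by blast
    then show thesis using that[of w] by (simp add: in_S)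
  qed
  show "\<gamma> * (of_nat (c 3) - 1) = of_nat (c 2) * (of_nat (c 2) - 1)"
    using sum_M[of "\<lambda>z. d z w = 1"] sum_M_neighbours[OF w(1) y] card_B_N[OF w(1) y] w(2)
    by simp
  obtain w where w: "w \<in> S 1 x" "d y w = 1"
  proof -
    have "S 1 x \<inter> S 1 y \<noteq> {}" using card_common[OF y] c2_pos by auto
    then obtain w where "w \<in> S 1 x" "w \<in> S 1 y" by blast
    then show thesis using that[of w] by (simp add: in_S)
  qed
  show "\<gamma> * (of_nat k - 2) = of_nat k + of_nat (c 2) ^ 2 - 3 * of_nat (c 2)"
  proof -
    have card: "of_nat (card {z\<in>Y. d y z = 2 \<and> d z w = 1}) = (of_nat k - 2 :: complex)"
      using card_B_N[OF w(1) y] w(2) by simp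
    show ?thesis using sum_M[of "\<lambda>z. d z w = 1"] w(2)
      unfolding sum_M_neighbours[OF w(1) y] card by (simp add: algebra_simps power2_eq_square)
  qed
qed

end

section \<open>The local spectrum\<close>

lemma char_poly_four_block_upper_right_zero:
  fixes A :: "'a :: idom mat"
  assumes "A \<in> carrier_mat n n" "C \<in> carrier_mat m n" "B \<in> carrier_mat m m"
  shows "char_poly (four_block_mat A (0\<^sub>m n m) C B) = char_poly A * char_poly B"
proof -
  have "char_poly_matrix (four_block_mat A (0\<^sub>m n m) C B) = four_block_mat
      (char_poly_matrix A) (0\<^sub>m n m) (map_mat (\<lambda>a. [:- a:]) C) (char_poly_matrix B)"
    using assms by (intro eq_matI) (auto simp: char_poly_matrix_def one_poly_def)
  then show ?thesis
    unfolding char_poly_def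
    using assms by (simp only:) (rule det_four_block_mat_upper_right_zero[of _ n _ m], auto)
qed

lemma char_poly_smult_one: "char_poly (e \<cdot>\<^sub>m 1\<^sub>m n :: 'a :: idom mat) = [:- e, 1:] ^ n"
proof -
  have "diag_mat (e \<cdot>\<^sub>m 1\<^sub>m n :: 'a mat) = replicate n e"
    by (rule nth_equalityI) (simp_all add: diag_mat_def)
  moreover have "upper_triangular (e \<cdot>\<^sub>m 1\<^sub>m n :: 'a mat)"
    by (simp add: upper_triangular_def)
  ultimately show ?thesis
    using char_poly_upper_triangular[of "e \<cdot>\<^sub>m 1\<^sub>m n :: 'a mat" n] by simp
qed

text \<open>Sylvester's relation between \<open>A * C\<close> and \<open>C * A\<close>: the block
  triangular \<open>?X\<close> and \<open>?Z\<close> are similar through \<open>?P\<close>, and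
  their characteristic polynomials factor over the diagonal blocks.\<close>

lemma char_poly_scalar_plus_mult:
  fixes A :: "'a :: idom mat"
  assumes A: "A \<in> carrier_mat n m" and C: "C \<in> carrier_mat m n"
  shows "char_poly (e \<cdot>\<^sub>m 1\<^sub>m n + A * C) * [:- e, 1:] ^ m
    = [:- e, 1:] ^ n * char_poly (e \<cdot>\<^sub>m 1\<^sub>m m + C * A)"
proof -
  let ?X = "four_block_mat (e \<cdot>\<^sub>m 1\<^sub>m n + A * C) (0\<^sub>m n m) C (e \<cdot>\<^sub>m 1\<^sub>m m)"
  let ?Z = "four_block_mat (e \<cdot>\<^sub>m 1\<^sub>m n) (0\<^sub>m n m) C (e \<cdot>\<^sub>m 1\<^sub>m m + C * A)"
  let ?P = "four_block_mat (1\<^sub>m n) A (0\<^sub>m m n) (1\<^sub>m m)"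
  define A' where "A' = - A"
  have A': "A' \<in> carrier_mat n m" using A by (simp add: A'_def)
  have A'A: "A' + A = 0\<^sub>m n m" using uminus_l_inv_mat[OF A] by (simp add: A'_def)
  then have AA': "A + A' = 0\<^sub>m n m" using comm_add_mat[OF A A'] by simp
  let ?Q = "four_block_mat (1\<^sub>m n) A' (0\<^sub>m m n) (1\<^sub>m m)"
  have AC: "A * C \<in> carrier_mat n n" and CA: "C * A \<in> carrier_mat m m" using A C by auto
  have carr: "?X \<in> carrier_mat (n + m) (n + m)" "?Z \<in> carrier_mat (n + m) (n + m)"
      "?P \<in> carrier_mat (n + m) (n + m)" "?Q \<in> carrier_mat (n + m) (n + m)"
    using AC CA by simp_all
  have PQ: "?P * ?Q = 1\<^sub>m (n + m)"
    using A A' AA' by (subst mult_four_block_mat[of _ n n _ m _ m _ _ n _ m]) (simp_all add: comm_add_mat[OF A' A])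
  have QP: "?Q * ?P = 1\<^sub>m (n + m)"
    using A A' AA' by (subst mult_four_block_mat[of _ n n _ m _ m _ _ n _ m]) (simp_all add: comm_add_mat[OF A' A])
  let ?E = "e \<cdot>\<^sub>m 1\<^sub>m n" and ?E' = "e \<cdot>\<^sub>m 1\<^sub>m m"
  have E: "?E \<in> carrier_mat n n" "?E' \<in> carrier_mat m m" by simp_all
  have EA: "?E * A = e \<cdot>\<^sub>m A" "A * ?E' = e \<cdot>\<^sub>m A"
    using A by (simp_all add: mult_smult_assoc_mat[OF one_carrier_mat A] mult_smult_distrib[OF A one_carrier_mat])
  have "(?E + A * C) * A = ?E * A + A * C * A" by (rule add_mult_distrib_mat[OF E(1) AC A])
  also have "\<dots> = A * ?E' + A * (C * A)" unfolding EA assoc_mult_mat[OF A C A] ..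
  also have "\<dots> = A * (?E' + C * A)" by (rule mult_add_distrib_mat[OF A E(2) CA, symmetric])
  finally have XA: "(?E + A * C) * A = A * (?E' + C * A)" .
  have "(?E + A * C) * A \<in> carrier_mat n m"
    by (rule mult_carrier_mat[OF add_carrier_mat[OF AC] A])
  then have "?X * ?P = four_block_mat (?E + A * C) ((?E + A * C) * A) C (C * A + ?E')"
    using A C AC CA by (subst mult_four_block_mat[of _ n n _ m _ m _ _ n _ m]) (simp_all add: right_add_zero_mat[of _ n m])
  moreover have "?P * ?Z = four_block_mat (?E + A * C) (A * (?E' + C * A)) C (?E' + C * A)"
    using A C AC CA by (subst mult_four_block_mat[of _ n n _ m _ m _ _ n _ m]) simp_all
  ultimately have XP: "?X * ?P = ?P * ?Z" unfolding XA comm_add_mat[OF CA E(2)] by simp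
  have "?X = ?X * (?P * ?Q)" unfolding PQ by (rule right_mult_one_mat[OF carr(1), symmetric])
  also have "\<dots> = ?P * ?Z * ?Q"
    unfolding XP[symmetric] by (rule assoc_mult_mat[OF carr(1,3,4), symmetric])
  finally have "similar_mat_wit ?X ?Z ?P ?Q"
    using carr PQ QP by (intro similar_mat_witI[of _ _ "n + m"])
  then have "char_poly ?X = char_poly ?Z"
    by (intro char_poly_similar) (auto simp: similar_mat_def)
  then show ?thesis
    using A C AC CA by (simp add: char_poly_four_block_upper_right_zero char_poly_smult_one)
qed

lemma proots_char_poly_scalar_plus_mult:
  fixes A :: "complex mat"
  assumes A: "A \<in> carrier_mat n m" and C: "C \<in> carrier_mat m n"
  shows "proots (char_poly (e \<cdot>\<^sub>m 1\<^sub>m n + A * C)) + replicate_mset m e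
    = replicate_mset n e + proots (char_poly (e \<cdot>\<^sub>m 1\<^sub>m m + C * A))"
proof -
  have nz: "char_poly X \<noteq> 0" if "X \<in> carrier_mat l l" for X :: "complex mat" and l
    using degree_monic_char_poly[OF that] by auto
  have 1: "proots ([:- e, 1:] ^ l) = replicate_mset l e" for l
    by (simp add: proots_power)
  have "char_poly (e \<cdot>\<^sub>m 1\<^sub>m n + A * C) \<noteq> 0" "char_poly (e \<cdot>\<^sub>m 1\<^sub>m m + C * A) \<noteq> 0"
    using A C by (auto intro!: nz)
  then show ?thesis
    using arg_cong[OF char_poly_scalar_plus_mult[OF A C, of e], of proots]
    by (simp add: proots_mult 1)
qed

text \<open>A constant matrix is a column times a row, so exchanging the factors leaves a matrix of
  size 1.\<close>

lemma proots_char_poly_scalar_plus_const: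
  fixes a t :: complex
  shows "proots (char_poly (mat n n (\<lambda>(i, j). (if i = j then a else 0) + t))) + {#a#}
    = replicate_mset n a + {#a + of_nat n * t#}"
proof -
  let ?A = "mat n 1 (\<lambda>_. t)" and ?C = "mat 1 n (\<lambda>_. 1)"
  have "mat n n (\<lambda>(i, j). (if i = j then a else 0) + t) = a \<cdot>\<^sub>m 1\<^sub>m n + ?A * ?C"
    by (intro eq_matI) (auto simp: scalar_prod_def)
  moreover have "a \<cdot>\<^sub>m 1\<^sub>m 1 + ?C * ?A = (a + of_nat n * t) \<cdot>\<^sub>m 1\<^sub>m 1"
    by (intro eq_matI) (auto simp: scalar_prod_def)
  ultimately show ?thesis
    using proots_char_poly_scalar_plus_mult[of ?A n 1 ?C a] by (simp add: char_poly_smult_one)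
qed

lemma sum_nth_distinct:
  assumes "distinct ws" "set ws = U"
  shows "(\<Sum>i<length ws. f (ws ! i)) = sum f U"
  using sum.reindex_bij_betw[OF bij_betw_nth[OF assms(1) refl assms(2)[symmetric]], of f] by simp

context bipartite_drg_based
begin

text \<open>With \<open>A\<close> equal to \<open>N\<^sup>T\<close> divided by \<gamma>, the local
  adjacency matrix is \<eta> times the identity plus \<open>A * N\<close>. Away from \<eta> its
  spectrum is that of the smaller matrix with \<open>N * A\<close>, which has constant diagonal and
  constant off-diagonal entries.\<close>

lemma local_spectrum:
  assumes M: "\<And>y z. y \<in> Y \<Longrightarrow> z \<in> Y \<Longrightarrow>
      M y z = of_nat (c 2) * of_bool (d y z = 0) + \<gamma> * of_bool (d y z = 2)"
    and vs: "distinct vs" "set vs = Y"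
  shows "set_mset (proots (char_poly (mat (length vs) (length vs)
        (\<lambda>(i, j). if d (vs ! i) (vs ! j) = 2 then 1 else 0)))
      - {# of_nat (p 2 2 2) #} - replicate_mset (k - 1) (of_nat k - of_nat (c 3) - 1))
    \<subseteq> {- of_nat (c 2) / \<gamma>}"
proof -
  have par: "\<gamma> * of_nat (p 2 2 2) = of_nat (c 2) * (of_nat k - 2)"
    "\<gamma> * (of_nat (c 3) - 1) = of_nat (c 2) * (of_nat (c 2) - 1)"
    "\<gamma> * (of_nat k - 2) = of_nat k + of_nat (c 2) ^ 2 - 3 * of_nat (c 2)"
    and \<gamma>: "\<gamma> \<noteq> 0"
    by (rule local_parameters[of \<gamma>]; rule M; assumption)+
  obtain ws where ws: "distinct ws" "set ws = S 1 x"
    using finite_distinct_list[of "S 1 x"] by auto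
  have len: "length ws = k" using distinct_card[OF ws(1)] ws(2) card_S_1[OF x_in] by simp
  define n where "n = length vs"
  define \<eta> where "\<eta> = - of_nat (c 2) / \<gamma>"
  define a where "a = of_nat k - of_nat (c 3) - (1 :: complex)"
  define t where "t = (of_nat (c 2) - 1) / \<gamma>"
  define N where "N = mat k n (\<lambda>(i, j). of_bool (d (vs ! j) (ws ! i) = 1) :: complex)"
  define A where "A = mat n k (\<lambda>(i, j). of_bool (d (vs ! i) (ws ! j) = 1) / \<gamma>)"
  have car: "A \<in> carrier_mat n k" "N \<in> carrier_mat k n" by (simp_all add: A_def N_def)
  then have dims: "dim_row A = n" "dim_col A = k" "dim_row N = k" "dim_col N = n" by auto
  let ?R = "mat k k (\<lambda>(i, j). (if i = j then a else 0) + t)"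
  let ?B = "mat n n (\<lambda>(i, j). if d (vs ! i) (vs ! j) = 2 then 1 else 0 :: complex)"
  \<comment> \<open>Subtracting the second relation from the third expresses \<open>a\<close>, which
    is \<open>b 3 - 1\<close>, through \<gamma>; this identifies the diagonal of
    \<open>?R\<close>.\<close>
  have \<gamma>a: "\<gamma> * a = of_nat k - 2 * of_nat (c 2)"
  proof -
    have "\<gamma> * a = \<gamma> * (of_nat k - 2) - \<gamma> * (of_nat (c 3) - 1)" by (simp add: a_def algebra_simps)
    then show ?thesis unfolding par by (simp add: algebra_simps power2_eq_square)
  qed
  have vsY: "vs ! i \<in> Y" if "i < n" for i using nth_mem[of i vs] that vs(2) n_def by simp
  have wsS: "ws ! i \<in> S 1 x" if "i < k" for i using nth_mem[of i ws] that ws(2) len by simp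
  have B_eq: "?B = \<eta> \<cdot>\<^sub>m 1\<^sub>m n + A * N"
  proof (intro eq_matI)
    fix i j assume "i < dim_row (\<eta> \<cdot>\<^sub>m 1\<^sub>m n + A * N)" "j < dim_col (\<eta> \<cdot>\<^sub>m 1\<^sub>m n + A * N)"
    then have ij: "i < n" "j < n" by (simp_all add: dims)
    have "(A * N) $$ (i, j) = (\<Sum>l<length ws. of_bool (d (vs ! i) (ws ! l) = 1) * of_bool (d (vs ! j) (ws ! l) = 1) / \<gamma>)"
      using ij by (simp add: A_def N_def scalar_prod_def len atLeast0LessThan)
    also have "\<dots> = (\<Sum>w\<in>S 1 x. of_bool (d (vs ! i) w = 1) * of_bool (d (vs ! j) w = 1) / \<gamma>)"
      by (rule sum_nth_distinct[OF ws, of "\<lambda>w. of_bool (d (vs ! i) w = 1) * of_bool (d (vs ! j) w = 1) / \<gamma>"])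
    also have "\<dots> = M (vs ! i) (vs ! j) / \<gamma>"
    proof -
      have "S 1 x \<inter> S 1 (vs ! i) = S 1 x \<inter> {w. d (vs ! i) w = 1}" by (auto simp: in_S)
      then show ?thesis unfolding M_eq_sum sum_divide_distrib
        by (simp only: sum.inter_restrict[OF finite_S]) (intro sum.cong refl, simp)
    qed
    finally have "(A * N) $$ (i, j) = M (vs ! i) (vs ! j) / \<gamma>" .
    moreover have "d (vs ! i) (vs ! j) = 0 \<longleftrightarrow> i = j"
      using d_eq_0[of "vs ! i" "vs ! j"] vsY[OF ij(1)] vsY[OF ij(2)] ij vs(1) n_def
      by (simp add: in_Y nth_eq_iff_index_eq)
    ultimately show "?B $$ (i, j) = (\<eta> \<cdot>\<^sub>m 1\<^sub>m n + A * N) $$ (i, j)"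
      using ij M[OF vsY[OF ij(1)] vsY[OF ij(2)]] \<gamma>
      by (cases "i = j") (simp_all add: dims \<eta>_def del: index_mult_mat(1))
  qed (simp_all add: dims)
  have R_eq: "\<eta> \<cdot>\<^sub>m 1\<^sub>m k + N * A = ?R"
  proof (intro eq_matI)
    fix i j assume "i < dim_row ?R" "j < dim_col ?R"
    then have ij: "i < k" "j < k" by simp_all
    have "(N * A) $$ (i, j) = (\<Sum>l<length vs. of_bool (d (vs ! l) (ws ! i) = 1) * of_bool (d (vs ! l) (ws ! j) = 1) / \<gamma>)"
      using ij by (simp add: A_def N_def scalar_prod_def n_def atLeast0LessThan)
    also have "\<dots> = (\<Sum>y\<in>Y. of_bool (d y (ws ! i) = 1) * of_bool (d y (ws ! j) = 1) / \<gamma>)"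
      by (rule sum_nth_distinct[OF vs, of "\<lambda>y. of_bool (d y (ws ! i) = 1) * of_bool (d y (ws ! j) = 1) / \<gamma>"])
    also have "\<dots> = of_nat (card {y\<in>Y. d y (ws ! i) = 1 \<and> d y (ws ! j) = 1}) / \<gamma>"
      unfolding sum_divide_distrib[symmetric] of_bool_conj[symmetric] by (simp add: Int_def)
    also have "\<dots> = (if i = j then of_nat k - 1 else of_nat (c 2) - 1) / \<gamma>"
      using card_Y_neighbours[OF wsS wsS, of i j] ij ws(1) len by (simp add: nth_eq_iff_index_eq)
    finally have "(N * A) $$ (i, j) = (if i = j then of_nat k - 1 else of_nat (c 2) - 1) / \<gamma>" .
    moreover have "\<eta> + (of_nat k - 1) / \<gamma> = a + t"
    proof -
      have a: "a = (of_nat k - 2 * of_nat (c 2)) / \<gamma>" using \<gamma> \<gamma>a by (simp add: field_simps)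
      show ?thesis unfolding a \<eta>_def t_def using \<gamma> by (simp add: field_simps)
    qed
    ultimately show "(\<eta> \<cdot>\<^sub>m 1\<^sub>m k + N * A) $$ (i, j) = ?R $$ (i, j)"
      using ij by (cases "i = j") (simp_all add: dims t_def del: index_mult_mat(1))
  qed (simp_all add: dims)
  \<comment> \<open>The eigenvalue of \<open>?R\<close> on the all-ones vector is the valency of the
    local graph.\<close>
  have top: "a + of_nat k * t = of_nat (p 2 2 2)"
  proof -
    have \<gamma>t: "\<gamma> * t = of_nat (c 2) - 1" using \<gamma> by (simp add: t_def)
    have "\<gamma> * (a + of_nat k * t) = \<gamma> * a + of_nat k * (\<gamma> * t)" by (simp add: algebra_simps)
    also have "\<dots> = \<gamma> * of_nat (p 2 2 2)" unfolding par(1) \<gamma>a \<gamma>t by (simp add: algebra_simps)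
    finally have "\<gamma> * (a + of_nat k * t) = \<gamma> * of_nat (p 2 2 2)" .
    then show ?thesis using \<gamma> by simp
  qed
  have spec: "proots (char_poly ?B) + replicate_mset k \<eta> = replicate_mset n \<eta> + proots (char_poly ?R)"
    unfolding B_eq R_eq[symmetric] by (rule proots_char_poly_scalar_plus_mult[OF car])
  have R: "proots (char_poly ?R) + {#a#} = replicate_mset k a + {#of_nat (p 2 2 2)#}"
    unfolding top[symmetric] by (rule proots_char_poly_scalar_plus_const)
  \<comment> \<open>The padding in \<open>spec\<close> consists of copies of \<eta>, so other
    multiplicities agree for \<open>?B\<close> and \<open>?R\<close>.\<close>
  have *: "count (proots (char_poly ?B)) e + (if e = a then 1 else 0)
      = (if e = a then k else 0) + (if e = of_nat (p 2 2 2) then 1 else 0)" if e: "e \<noteq> \<eta>" for e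
  proof -
    have "count (proots (char_poly ?B)) e = count (proots (char_poly ?R)) e"
      using arg_cong[OF spec, of "\<lambda>X. count X e"] e by (simp only: count_union) simp
    moreover have "count (proots (char_poly ?R)) e + count {#a#} e
        = count (replicate_mset k a) e + count {#of_nat (p 2 2 2)#} e"
      using arg_cong[OF R, of "\<lambda>X. count X e"] by (simp only: count_union)
    ultimately show ?thesis by (simp only: count_single count_replicate_mset eq_commute)
  qed
  have "e \<in> {\<eta>}" if "e \<in># proots (char_poly ?B) - {# of_nat (p 2 2 2) #} - replicate_mset (k - 1) a" for e
  proof (rule ccontr)
    assume "e \<notin> {\<eta>}"
    then have e: "e \<noteq> \<eta>" by simp
    have "count {#of_nat (p 2 2 2)#} e + count (replicate_mset (k - 1) a) e < count (proots (char_poly ?B)) e"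
      using that by (simp only: in_diff_count count_diff less_diff_conv add.commute)
    then have "(if e = of_nat (p 2 2 2) then 1 else 0) + (if e = a then k - 1 else 0)
        < count (proots (char_poly ?B)) e"
      by (simp only: count_single count_replicate_mset eq_commute)
    then show False using *[OF e] k_ge by (cases "e = a") simp_all
  qed
  then show ?thesis unfolding \<eta>_def a_def n_def by blast
qed
end

section \<open>Distance-regular graphs as metrics\<close>

text \<open>The pair \<open>u\<close>, \<open>w\<close> itself realises the distance, so the number
  described by \<open>THE\<close> in \<open>pnum\<close> is unique.\<close>

lemma card_sphere_Int:
  assumes "distance_regular G" "u \<in> pverts G" "w \<in> pverts G"
  shows "card (sphere G i u \<inter> sphere G j w) = pnum G (gdist G u w) i j"
proof -
  let ?P = "\<lambda>q. \<forall>u'\<in>pverts G. \<forall>w'\<in>pverts G. gdist G u' w' = gdist G u w \<longrightarrow>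
    card (sphere G i u' \<inter> sphere G j w') = q"
  have "\<forall>h i j. \<exists>q. \<forall>u\<in>pverts G. \<forall>w\<in>pverts G.
      gdist G u w = h \<longrightarrow> card (sphere G i u \<inter> sphere G j w) = q"
    using assms(1) unfolding distance_regular_def by (elim conjE)
  then have "\<exists>q. ?P q" by (elim allE)
  then obtain q where q: "?P q" ..
  have eq: "card (sphere G i u \<inter> sphere G j w) = q'" if "?P q'" for q'
    using bspec[OF bspec[OF that assms(2)] assms(3)] by simp
  have "?P (card (sphere G i u \<inter> sphere G j w))" unfolding eq[OF q] by (rule q)
  then have "(THE q'. ?P q') = card (sphere G i u \<inter> sphere G j w)"
    by (rule the_equality) (simp only: eq)
  then show ?thesis unfolding pnum_def ..
qed

lemma distance_regular_bipartite_drg: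
  assumes "distance_regular G" "bipartite G"
  shows "bipartite_drg (pverts G) (gdist G) (pnum G) (diam G)"
proof -
  interpret pair_graph G using assms(1) by (simp add: distance_regular_def)
  interpret pair_connected_graph G
    using assms(1) by unfold_locales (simp add: distance_regular_def)
  show ?thesis
  proof (rule bipartite_drg.intro, goal_cases)
    case (7 u w i j)
    then show ?case using card_sphere_Int[OF assms(1), of u w i j] by (simp add: sphere_def)
  qed (fact pair_finite_verts gdist_eq_0_iff gdist_sym gdist_triangle gdist_geodesic
      gdist_parity[OF assms(2)] diam_ge diam_attained)+
qed

theorem theorem8p7:
  fixes G :: "'a pair_pre_digraph" and x :: 'a and \<alpha> \<beta> :: "nat \<Rightarrow> complex"
  assumes "distance_regular G" and "bipartite G"
    and "diam G \<ge> 4" and "valency G \<ge> 3"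
    and "x \<in> pverts G"
    and "\<And>i y z. 2 \<le> i \<Longrightarrow> i \<le> diam G - 2 \<Longrightarrow> y \<in> pverts G \<Longrightarrow> z \<in> pverts G \<Longrightarrow>
           gdist G x y = 2 \<Longrightarrow> gdist G x z = i \<Longrightarrow> gdist G y z = i \<Longrightarrow>
           \<alpha> i + \<beta> i * of_nat (card (sphere G 1 x \<inter> sphere G 1 y \<inter> sphere G (i - 1) z))
             = of_nat (card (sphere G (i - 1) x \<inter> sphere G (i - 1) y \<inter> sphere G 1 z))"
    and "\<exists>i. 3 \<le> i \<and> i \<le> diam G - 2 \<and> \<alpha> i = 0"
  shows "card (Phi2 G x) \<le> 1 \<and> Delta2 G = 0"
proof -
  interpret bipartite_drg "pverts G" "gdist G" "pnum G" "diam G"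
    by (rule distance_regular_bipartite_drg[OF assms(1,2)])
  have S: "S i z = sphere G i z" for i z by (simp add: S_def sphere_def)
  have k: "k = valency G" and c: "c i = cnum G i" for i
    by (simp_all add: k_def b_def valency_def bnum_def c_def cnum_def)
  interpret bipartite_drg_based "pverts G" "gdist G" "pnum G" "diam G" x
    using assms(3-5) k by unfold_locales auto
  have Y: "Y = sphere G 2 x" by (simp add: Y_def S)
  have cond: "cond (\<alpha> i) (\<beta> i) i" if "3 \<le> i" "i + 2 \<le> diam G" for i
    unfolding cond_def m_def using assms(6)[of i] that by (auto simp: S in_Y sphere_def)
  obtain i0 where "3 \<le> i0" "i0 + 2 \<le> diam G" "\<alpha> i0 = 0" using assms(3,7) by auto
  then obtain \<eta> where "\<And>v y. v \<in> W \<Longrightarrow> y \<in> Y \<Longrightarrow> F 2 v y = \<eta> * v y"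
    using local_scalar[of \<alpha> \<beta>] cond by blast
  then obtain \<gamma> where M: "\<And>y z. y \<in> Y \<Longrightarrow> z \<in> Y \<Longrightarrow>
      M y z = of_nat (c 2) * of_bool (gdist G y z = 0) + \<gamma> * of_bool (gdist G y z = 2)"
    using M_constant by metis
  have par: "\<gamma> * of_nat (pnum G 2 2 2) = of_nat (c 2) * (of_nat k - 2)"
    "\<gamma> * (of_nat (c 3) - 1) = of_nat (c 2) * (of_nat (c 2) - 1)" "\<gamma> \<noteq> 0"
    using local_parameters[of \<gamma>] M by blast+
  \<comment> \<open>After multiplication by the nonzero \<gamma>, both products become
    \<open>c 2 * (c 2 - 1) * (k - 2)\<close> by \<open>par\<close>.\<close>
  have "\<gamma> * of_int (Delta2 G) = (of_nat k - 2) * (\<gamma> * (of_nat (c 3) - 1))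
      - (of_nat (c 2) - 1) * (\<gamma> * of_nat (pnum G 2 2 2))"
    by (simp add: Delta2_def k c algebra_simps)
  also have "\<dots> = 0" unfolding par by (simp add: algebra_simps)
  finally have "Delta2 G = 0" using par(3) by simp
  moreover have "card (Phi2 G x) \<le> 1"
  proof -
    \<comment> \<open>The very enumeration chosen in \<open>graph_spectrum\<close>.\<close>
    define vs where "vs = (SOME vs. distinct vs \<and> set vs = pverts (local_graph2 G x))"
    have "\<exists>vs. distinct vs \<and> set vs = pverts (local_graph2 G x)"
      using finite_distinct_list[OF finite_Y] by (auto simp: local_graph2_def Y)
    then have "distinct vs \<and> set vs = pverts (local_graph2 G x)"
      unfolding vs_def by (rule someI_ex)
    then have vs: "distinct vs" "set vs = Y" by (simp_all add: local_graph2_def Y)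
    have "adjacency_matrix (local_graph2 G x) vs = mat (length vs) (length vs)
        (\<lambda>(i, j). if gdist G (vs ! i) (vs ! j) = 2 then 1 else 0)"
      using vs nth_mem[of _ vs] by (intro eq_matI) (auto simp: adjacency_matrix_def local_graph2_def Y)
    moreover have "of_nat (bnum G 3) - 1 = (of_nat k - of_nat (c 3) - 1 :: complex)"
    proof -
      obtain u v where "u \<in> pverts G" "v \<in> pverts G" "gdist G u v = 3"
        using pair_exists[of 3] assms(3) by auto
      then have "b 3 + c 3 = k" using b_plus_c[of v u 2] by simp
      moreover have "b 3 = bnum G 3" by (simp add: b_def bnum_def)
      ultimately show ?thesis by (metis add_diff_cancel_right' of_nat_add)
    qed
    ultimately have "Phi2 G x \<subseteq> {- of_nat (c 2) / \<gamma>}"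
      using local_spectrum[OF M vs] unfolding Phi2_def graph_spectrum_def vs_def[symmetric]
      by (simp add: k)
    then have "card (Phi2 G x) \<le> card {- of_nat (c 2) / \<gamma>}" by (intro card_mono) auto
    then show ?thesis by simp
  qed
  ultimately show ?thesis by blast
qed

end
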